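(* Let $\Gamma$ be a closed curve in $\mathbb R^3$ of class $C^1$. Then for any $p>1$ we have $$2\pi\le\mathcal E_p(\Gamma)^{\frac1p}\,\mathcal H^1(\Gamma)^{1-\frac2p},$$ with equality if and only if $\Gamma$ is a round circle.
   Context: Closed curves are understood to be embedded, so that $\Gamma$ has a tangent line $T_x\Gamma$ (as a linear subspace) at every $x\in\Gamma$. For distinct $x,y\in\Gamma$ the tangent-point radius is $$R_{tp}(x,y):=\frac{|x-y|^2}{2\,\mathrm{dist}(x-y,T_x\Gamma)}\in(0,\infty]$$ (so $1/R_{tp}(x,y)=0$ if $x-y\in T_x\Gamma$). The $L^p$-tangent-point energy is $$\mathcal E_p(\Gamma):=\int_\Gamma\int_\Gamma\frac1{R_{tp}(x,y)^p}\,d\mathcal H^1(x)\,d\mathcal H^1(y)\in[0,\infty].$$ *)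

theory Defs
  imports "HOL-Analysis.Analysis"
begin

text \<open>
  One-dimensional Hausdorff measure, normalised by \<open>H\<^sup>1(A) = lim\<^bsub>\<delta>\<rightarrow>0\<^esub> inf \<Sum> diam C\<^sub>i\<close>, so
  that it agrees with length on curves. The sets of the cover are required to be bounded because
  \<^const>\<open>diameter\<close> is real-valued and unspecified on unbounded sets.
\<close>

definition hausdorff1_pre :: "real \<Rightarrow> 'a::metric_space set \<Rightarrow> ennreal" where
  "hausdorff1_pre \<delta> A =
     (INF C \<in> {C :: nat \<Rightarrow> 'a set. A \<subseteq> (\<Union>i. C i) \<and> (\<forall>i. bounded (C i) \<and> diameter (C i) \<le> \<delta>)}.
        \<Sum>i. ennreal (diameter (C i)))"

definition hausdorff1_outer :: "'a::metric_space set \<Rightarrow> ennreal" where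
  "hausdorff1_outer A = (SUP \<delta> \<in> {0<..}. hausdorff1_pre \<delta> A)"

text \<open>
  The outer measure is a metric one, hence countably additive on the Borel sets, where it therefore
  coincides with \<^const>\<open>emeasure\<close> of the following measure.
\<close>

definition hausdorff1 :: "'a::metric_space measure" where
  "hausdorff1 = measure_of UNIV (sets borel) hausdorff1_outer"

text \<open>
  An embedded closed curve of class \<open>C\<^sup>1\<close>: the image of a \<open>1\<close>-periodic \<open>C\<^sup>1\<close> immersion of the
  line that is injective modulo the period.
\<close>

definition closed_C1_curve :: "'a::euclidean_space set \<Rightarrow> bool" where
  "closed_C1_curve \<Gamma> \<longleftrightarrow>
     (\<exists>\<gamma> :: real \<Rightarrow> 'a.
        \<gamma> C1_differentiable_on UNIV \<and>
        (\<forall>t. vector_derivative \<gamma> (at t) \<noteq> 0) \<and>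
        (\<forall>t. \<gamma> (t + 1) = \<gamma> t) \<and>
        inj_on \<gamma> {0..<1} \<and>
        \<Gamma> = range \<gamma>)"

text \<open>
  The tangent space as the set of velocities at \<open>x\<close> of \<open>C\<^sup>1\<close> curves running in \<open>\<Gamma>\<close>. For an embedded
  closed curve of class \<open>C\<^sup>1\<close> this is the line spanned by \<open>\<gamma>'(t)\<close>, where \<open>\<gamma>\<close> is any
  parametrization as above and \<open>\<gamma>(t) = x\<close>.
\<close>

definition tangent_space :: "'a::euclidean_space set \<Rightarrow> 'a \<Rightarrow> 'a set" where
  "tangent_space \<Gamma> x =
     {v. \<exists>(c :: real \<Rightarrow> 'a) \<epsilon>. \<epsilon> > 0 \<and> c C1_differentiable_on {-\<epsilon><..<\<epsilon>} \<and>
           c ` {-\<epsilon><..<\<epsilon>} \<subseteq> \<Gamma> \<and> c 0 = x \<and> (c has_vector_derivative v) (at 0)}"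

text \<open>
  For \<open>x \<noteq> y\<close> and \<open>x - y\<close> tangent at \<open>x\<close>, division by zero in \<^typ>\<open>ennreal\<close> yields the intended
  value \<open>\<infinity>\<close>. On the diagonal the value is \<open>0\<close> by convention.
\<close>

definition tangent_point_radius :: "'a::euclidean_space set \<Rightarrow> 'a \<Rightarrow> 'a \<Rightarrow> ennreal" where
  "tangent_point_radius \<Gamma> x y =
     ennreal ((norm (x - y))\<^sup>2) / ennreal (2 * infdist (x - y) (tangent_space \<Gamma> x))"

text \<open>Real powers on \<open>[0, \<infinity>]\<close>, with the usual limiting values at \<open>0\<close> and \<open>\<infinity>\<close>.\<close>

definition ennpowr :: "ennreal \<Rightarrow> real \<Rightarrow> ennreal" where
  "ennpowr x a =
     (if a = 0 then 1
      else if x = 0 then (if a > 0 then 0 else \<infinity>)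
      else if x = \<infinity> then (if a > 0 then \<infinity> else 0)
      else ennreal (enn2real x powr a))"

text \<open>
  The diagonal \<open>x = y\<close>, where the integrand has no meaning, does not contribute, since for each
  \<open>y\<close> it is a single point and thus null in the inner integral.
\<close>

definition tangent_point_energy :: "real \<Rightarrow> 'a::euclidean_space set \<Rightarrow> ennreal" where
  "tangent_point_energy p \<Gamma> =
     (\<integral>\<^sup>+y\<in>\<Gamma>. (\<integral>\<^sup>+x\<in>\<Gamma>. 1 / ennpowr (tangent_point_radius \<Gamma> x y) p \<partial>hausdorff1) \<partial>hausdorff1)"

definition round_circle :: "'a::euclidean_space set \<Rightarrow> bool" where
  "round_circle \<Gamma> \<longleftrightarrow>
     (\<exists>a r P. r > 0 \<and> affine P \<and> aff_dim P = 2 \<and> a \<in> P \<and> \<Gamma> = sphere a r \<inter> P)"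

end

theory Submission
  imports Defs
begin

text \<open>
  Fix a point \<open>y\<close> of the curve and look at the rest of the curve from \<open>y\<close>, through the direction
  \<open>\<omega>(t) = (\<gamma> t - y) / \<bar>\<gamma> t - y\<bar>\<close>. The part of the velocity \<open>\<gamma>'(t)\<close> orthogonal to the chord is what turns
  \<open>\<omega>\<close>, and the distance of the chord from the tangent line at \<open>\<gamma> t\<close> measures the same angle, so that
  \<open>2 \<bar>\<omega>'(t)\<bar> = \<bar>\<gamma>'(t)\<bar> / R\<^sub>t\<^sub>p(\<gamma> t, y)\<close>. As \<open>t\<close> runs once around the curve, \<open>\<omega>\<close> is a path on the
  unit sphere from the unit tangent at \<open>y\<close> to its opposite, and such a path has length at least
  \<open>\<pi>\<close>. Hence the inner integral of \<open>1 / R\<^sub>t\<^sub>p\<close> is at least \<open>2 \<pi>\<close> for every single \<open>y\<close>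
  (lemma \<open>curvature_integral_ge\<close>).

  Let \<open>L\<close> be the length and \<open>c = 2 \<pi> / L\<close> the curvature of the circle of that length. Integrating
  the inequality \<open>a\<^sup>p \<ge> c\<^sup>p + p c\<^sup>p\<^sup>-\<^sup>1 (a - c)\<close> over \<open>a = 1 / R\<^sub>t\<^sub>p\<close> turns the bound for exponent \<open>1\<close> into
  the bound \<open>c\<^sup>p L\<close> for the inner integral with exponent \<open>p\<close>, and integrating over \<open>y\<close> gives
  \<open>\<E>\<^sub>p \<ge> c\<^sup>p L\<^sup>2\<close>, which is the assertion (lemma \<open>two_pi_le_energy_length\<close>).

  In the case of equality the strictness of that inequality and continuity force \<open>1 / R\<^sub>t\<^sub>p = c\<close> for all
  pairs of distinct points (lemma \<open>energy_minimal_imp_curvature_const\<close>). Then \<open>\<omega>\<close> has length exactly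
  \<open>\<pi>\<close> and is half of a great circle, so the curve is planar. The condition \<open>R\<^sub>t\<^sub>p(y, \<gamma> t) = 1 / c\<close>, with
  the roles of the two points exchanged, gives the length of the chord as \<open>2 / c\<close> times the sine of
  its angle with the tangent at \<open>y\<close>, which is the equation of a circle in polar coordinates around
  one of its points (lemma \<open>curvature_const_imp_circular\<close>). Conversely a direct computation shows
  that \<open>R\<^sub>t\<^sub>p\<close> is constant on a circle (lemma \<open>round_circle_tp_curvature\<close>).

  The measure-theoretic part identifies the Hausdorff measure on the curve with
  \<open>\<bar>\<gamma>'(t)\<bar> dt\<close> (lemma \<open>nn_integral_curve\<close>), and the tangent space with the line spanned by
  \<open>\<gamma>'(t)\<close> (lemma \<open>tangent_space_curve\<close>).
\<close>

section \<open>The one-dimensional Hausdorff measure is a Borel measure\<close>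

lemma hausdorff1_pre_mono: "A \<subseteq> B \<Longrightarrow> hausdorff1_pre \<delta> A \<le> hausdorff1_pre \<delta> B"
  unfolding hausdorff1_pre_def by (rule INF_superset_mono) auto

lemma hausdorff1_pre_antimono: "\<delta> \<le> \<epsilon> \<Longrightarrow> hausdorff1_pre \<epsilon> A \<le> hausdorff1_pre \<delta> A"
  unfolding hausdorff1_pre_def by (rule INF_superset_mono) (auto intro: order_trans)

lemma hausdorff1_pre_le:
  assumes "A \<subseteq> (\<Union>i. C i)" "\<And>i. bounded (C i)" "\<And>i. diameter (C i) \<le> \<delta>"
  shows "hausdorff1_pre \<delta> A \<le> (\<Sum>i. ennreal (diameter (C i)))"
  unfolding hausdorff1_pre_def by (rule INF_lower) (use assms in auto)

lemma hausdorff1_pre_empty: "\<delta> > 0 \<Longrightarrow> hausdorff1_pre \<delta> {} = 0"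
  using hausdorff1_pre_le[of "{}" "\<lambda>_. {}" \<delta>] by simp

text \<open>
  Covers of the individual sets, the \<open>n\<close>-th one optimal up to \<open>e / 2\<^sup>n\<^sup>+\<^sup>1\<close>, are enumerated as a single
  cover of the union.
\<close>

lemma hausdorff1_pre_countably_subadditive:
  "hausdorff1_pre \<delta> (\<Union>n. A n) \<le> (\<Sum>n. hausdorff1_pre \<delta> (A n))"
proof (rule ennreal_le_epsilon)
  fix e :: real assume "0 < e" and fin: "(\<Sum>n. hausdorff1_pre \<delta> (A n)) < top"
  then have *: "hausdorff1_pre \<delta> (A n) < hausdorff1_pre \<delta> (A n) + e * (1/2)^Suc n" for n
    by (auto simp add: less_top dest!: ennreal_suminf_lessD)
  have "\<exists>C. A n \<subseteq> (\<Union>i. C i) \<and> (\<forall>i. bounded (C i) \<and> diameter (C i) \<le> \<delta>) \<and>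
          (\<Sum>i. ennreal (diameter (C i))) \<le> hausdorff1_pre \<delta> (A n) + e * (1/2)^Suc n" for n
    using *[of n] unfolding hausdorff1_pre_def[of \<delta> "A n"] INF_less_iff
    by (auto dest: less_imp_le)
  then obtain C where C: "\<And>n. A n \<subseteq> (\<Union>i. C n i)"
    "\<And>n i. bounded (C n i)" "\<And>n i. diameter (C n i) \<le> \<delta>"
    "\<And>n. (\<Sum>i. ennreal (diameter (C n i))) \<le> hausdorff1_pre \<delta> (A n) + e * (1/2)^Suc n"
    by metis
  define D where "D = case_prod C o prod_decode"
  have "(\<Union>n. A n) \<subseteq> (\<Union>i. D i)"
    using C(1) by (auto simp add: D_def subset_eq) (metis prod.case prod_encode_inverse)
  then have "hausdorff1_pre \<delta> (\<Union>n. A n) \<le> (\<Sum>i. ennreal (diameter (D i)))"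
    by (rule hausdorff1_pre_le) (auto simp: D_def C split: prod.split)
  also have "\<dots> = (\<Sum>n. \<Sum>i. ennreal (diameter (C n i)))"
    unfolding D_def comp_def
    using suminf_ennreal_2dimen[of "\<lambda>n. \<Sum>i. ennreal (diameter (C n i))"
        "\<lambda>x. ennreal (diameter (case_prod C x))"] by simp
  also have "\<dots> \<le> (\<Sum>n. hausdorff1_pre \<delta> (A n) + e * (1/2) ^ Suc n)"
    by (intro suminf_le C(4)) auto
  also have "... = (\<Sum>n. hausdorff1_pre \<delta> (A n)) + (\<Sum>n. ennreal e * ennreal ((1/2) ^ Suc n))"
    using \<open>0 < e\<close> by (subst suminf_add[symmetric])
                     (auto simp del: ennreal_suminf_cmult simp add: ennreal_mult[symmetric])
  also have "\<dots> = (\<Sum>n. hausdorff1_pre \<delta> (A n)) + e"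
    unfolding ennreal_suminf_cmult
    by (subst suminf_ennreal_eq[OF zero_le_power power_half_series]) auto
  finally show "hausdorff1_pre \<delta> (\<Union>n. A n) \<le> (\<Sum>n. hausdorff1_pre \<delta> (A n)) + e" .
qed

text \<open>
  A covering set of diameter at most \<open>\<delta>\<close> cannot meet both of two sets that are further than \<open>\<delta>\<close>
  apart, so a cover of the union splits into a cover of each.
\<close>

lemma hausdorff1_pre_separated:
  assumes sep: "\<And>x y. x \<in> A \<Longrightarrow> y \<in> B \<Longrightarrow> \<delta> < dist x y"
  shows "hausdorff1_pre \<delta> A + hausdorff1_pre \<delta> B \<le> hausdorff1_pre \<delta> (A \<union> B)"
  unfolding hausdorff1_pre_def[of \<delta> "A \<union> B"]
proof (rule INF_greatest)
  fix C :: "nat \<Rightarrow> _" assume "C \<in> {C. A \<union> B \<subseteq> (\<Union>i. C i) \<and> (\<forall>i. bounded (C i) \<and> diameter (C i) \<le> \<delta>)}"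
  then have cover: "A \<union> B \<subseteq> (\<Union>i. C i)" and bd: "\<And>i. bounded (C i)" and dC: "\<And>i. diameter (C i) \<le> \<delta>"
    by auto
  have sub: "diameter (C i \<inter> S) \<le> diameter (C i)" for i S
    by (rule diameter_subset) (auto simp: bd)
  have pre: "hausdorff1_pre \<delta> S \<le> (\<Sum>i. ennreal (diameter (C i \<inter> S)))" if "S \<subseteq> A \<union> B" for S
  proof (rule hausdorff1_pre_le)
    show "S \<subseteq> (\<Union>i. C i \<inter> S)" using that cover by blast
    show "bounded (C i \<inter> S)" for i by (rule bounded_subset[OF bd]) auto
    show "diameter (C i \<inter> S) \<le> \<delta>" for i using sub[of i S] dC[of i] by linarith
  qed
  have one: "C i \<inter> A = {} \<or> C i \<inter> B = {}" for i
  proof (rule ccontr)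
    assume "\<not> ?thesis"
    then obtain x y where "x \<in> C i" "x \<in> A" "y \<in> C i" "y \<in> B" by blast
    then show False
      using sep[of x y] diameter_bounded_bound[OF bd, of x i y] dC[of i] by linarith
  qed
  have "hausdorff1_pre \<delta> A + hausdorff1_pre \<delta> B
      \<le> (\<Sum>i. ennreal (diameter (C i \<inter> A))) + (\<Sum>i. ennreal (diameter (C i \<inter> B)))"
    by (intro add_mono pre) auto
  also have "\<dots> = (\<Sum>i. ennreal (diameter (C i \<inter> A)) + ennreal (diameter (C i \<inter> B)))"
    by (rule suminf_add) auto
  also have "\<dots> \<le> (\<Sum>i. ennreal (diameter (C i)))"
  proof (intro suminf_le allI)
    show "ennreal (diameter (C i \<inter> A)) + ennreal (diameter (C i \<inter> B)) \<le> ennreal (diameter (C i))" for i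
      using one[of i] sub[of i A] sub[of i B] by (auto intro: ennreal_leI)
  qed auto
  finally show "hausdorff1_pre \<delta> A + hausdorff1_pre \<delta> B \<le> (\<Sum>i. ennreal (diameter (C i)))" .
qed

lemma hausdorff1_outer_mono: "A \<subseteq> B \<Longrightarrow> hausdorff1_outer A \<le> hausdorff1_outer B"
  unfolding hausdorff1_outer_def by (rule SUP_mono') (rule hausdorff1_pre_mono)

lemma hausdorff1_pre_le_outer: "\<delta> > 0 \<Longrightarrow> hausdorff1_pre \<delta> A \<le> hausdorff1_outer A"
  unfolding hausdorff1_outer_def by (rule SUP_upper) auto

lemma hausdorff1_outer_empty: "hausdorff1_outer {} = 0"
  unfolding hausdorff1_outer_def by (auto simp: hausdorff1_pre_empty)

lemma hausdorff1_outer_countably_subadditive: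
  "hausdorff1_outer (\<Union>n. A n) \<le> (\<Sum>n. hausdorff1_outer (A n))"
  unfolding hausdorff1_outer_def[of "\<Union>n. A n"]
proof (rule SUP_least)
  fix \<delta> :: real assume "\<delta> \<in> {0<..}"
  then have "(\<Sum>n. hausdorff1_pre \<delta> (A n)) \<le> (\<Sum>n. hausdorff1_outer (A n))"
    by (intro suminf_le hausdorff1_pre_le_outer) auto
  then show "hausdorff1_pre \<delta> (\<Union>n. A n) \<le> (\<Sum>n. hausdorff1_outer (A n))"
    using hausdorff1_pre_countably_subadditive order_trans by blast
qed

lemma outer_measure_space_hausdorff1:
  "outer_measure_space UNIV (hausdorff1_outer :: 'a::metric_space set \<Rightarrow> ennreal)"
  by (auto simp: outer_measure_space_def positive_def increasing_def countably_subadditive_def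
      hausdorff1_outer_empty hausdorff1_outer_mono hausdorff1_outer_countably_subadditive)

lemma hausdorff1_outer_Un: "hausdorff1_outer (A \<union> B) \<le> hausdorff1_outer A + hausdorff1_outer B"
  using hausdorff1_outer_countably_subadditive[of "binaryset A B"]
  by (simp add: UN_binaryset_eq suminf_binaryset_eq hausdorff1_outer_empty)

text \<open>
  Additivity on sets at positive distance is inherited from the premeasures with small \<open>\<delta>\<close>; the
  supremum over \<open>\<delta>\<close> is a monotone limit, which lets the two suprema be taken together.
\<close>

lemma hausdorff1_outer_separated:
  assumes "d > 0" and sep: "\<And>x y. x \<in> A \<Longrightarrow> y \<in> B \<Longrightarrow> d \<le> dist x y"
  shows "hausdorff1_outer A + hausdorff1_outer B \<le> hausdorff1_outer (A \<union> B)"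
proof -
  have "hausdorff1_outer A + hausdorff1_outer B
      = (SUP \<delta>\<in>{0<..}. hausdorff1_pre \<delta> A + hausdorff1_pre \<delta> B)"
    unfolding hausdorff1_outer_def
  proof (rule SUP_add_directed_ennreal[symmetric])
    fix i j :: real assume "i \<in> {0<..}" "j \<in> {0<..}"
    then show "\<exists>k\<in>{0<..}. hausdorff1_pre i A + hausdorff1_pre j B \<le> hausdorff1_pre k A + hausdorff1_pre k B"
      by (intro bexI[of _ "min i j"] add_mono hausdorff1_pre_antimono) auto
  qed
  also have "\<dots> \<le> hausdorff1_outer (A \<union> B)"
  proof (rule SUP_least)
    fix \<delta> :: real assume \<delta>: "\<delta> \<in> {0<..}"
    let ?e = "min \<delta> (d / 2)"
    have "hausdorff1_pre \<delta> A + hausdorff1_pre \<delta> B \<le> hausdorff1_pre ?e A + hausdorff1_pre ?e B"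
      by (intro add_mono hausdorff1_pre_antimono) auto
    also have "\<dots> \<le> hausdorff1_pre ?e (A \<union> B)"
      by (rule hausdorff1_pre_separated) (use sep \<open>d > 0\<close> in \<open>fastforce simp: min_less_iff_disj\<close>)
    also have "\<dots> \<le> hausdorff1_outer (A \<union> B)"
      using \<delta> \<open>d > 0\<close> by (intro hausdorff1_pre_le_outer) auto
    finally show "hausdorff1_pre \<delta> A + hausdorff1_pre \<delta> B \<le> hausdorff1_outer (A \<union> B)" .
  qed
  finally show ?thesis .
qed

lemma hausdorff1_outer_separated_sum:
  assumes gap: "\<And>i j. i < j \<Longrightarrow> \<exists>d>0. \<forall>k\<ge>j. \<forall>x\<in>S i. \<forall>y\<in>S k. d \<le> dist x y"
  shows "(\<Sum>i. hausdorff1_outer (S i)) \<le> hausdorff1_outer (\<Union>i. S (i::nat))"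
proof (rule suminf_le_const[OF summableI])
  fix n
  have "(\<Sum>i\<in>{m..<m+n}. hausdorff1_outer (S i)) \<le> hausdorff1_outer (\<Union>i\<in>{m..}. S i)" for m
  proof (induction n arbitrary: m)
    case (Suc n)
    have U: "(\<Union>i\<in>{m..}. S i) = S m \<union> (\<Union>i\<in>{Suc m..}. S i)"
    proof -
      have "{m..} = insert m {Suc m..}" by auto
      then show ?thesis by simp
    qed
    obtain d where "d > 0" "\<And>k x y. k \<ge> Suc m \<Longrightarrow> x \<in> S m \<Longrightarrow> y \<in> S k \<Longrightarrow> d \<le> dist x y"
      using gap[of m "Suc m"] by auto
    then have "hausdorff1_outer (S m) + hausdorff1_outer (\<Union>i\<in>{Suc m..}. S i)
        \<le> hausdorff1_outer (\<Union>i\<in>{m..}. S i)"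
      unfolding U by (intro hausdorff1_outer_separated[of d]) auto
    moreover have "(\<Sum>i\<in>{m..<m+Suc n}. hausdorff1_outer (S i))
        = hausdorff1_outer (S m) + (\<Sum>i\<in>{Suc m..<Suc m+n}. hausdorff1_outer (S i))"
      by (subst sum.atLeast_Suc_lessThan) auto
    ultimately show ?case
      using add_left_mono[OF Suc.IH[of "Suc m"], of "hausdorff1_outer (S m)"] by (simp only:)
  qed simp
  from this[of 0] show "(\<Sum>i<n. hausdorff1_outer (S i)) \<le> hausdorff1_outer (\<Union>i. S i)"
    by (simp add: atLeast0LessThan)
qed

text \<open>
  This is the criterion of Caratheodory for metric outer measures. The points of \<open>E\<close> outside the
  closed set \<open>A\<close> are exhausted by sets at positive distance from \<open>A\<close>; what remains near \<open>A\<close> is a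
  union of shells, the shells with even index are at positive distance from each other, and so are
  those with odd index. Hence the measures of the shells have a finite sum and their tail vanishes.
\<close>

lemma closed_in_lambda_system_hausdorff1:
  assumes "closed A"
  shows "A \<in> lambda_system UNIV UNIV hausdorff1_outer"
proof (cases "A = {}")
  case True
  then show ?thesis by (simp add: lambda_system_def hausdorff1_outer_empty)
next
  case ne: False
  have "hausdorff1_outer (A \<inter> E) + hausdorff1_outer ((UNIV - A) \<inter> E) = hausdorff1_outer E" for E
  proof (rule antisym)
    have "E = (A \<inter> E) \<union> ((UNIV - A) \<inter> E)" by auto
    then show "hausdorff1_outer E \<le> hausdorff1_outer (A \<inter> E) + hausdorff1_outer ((UNIV - A) \<inter> E)"
      using hausdorff1_outer_Un by metis
    \<comment> \<open>The radii of the shells around \<open>A\<close>: the shell \<open>S k\<close> lies between distance \<open>r (k + 1)\<close> and \<open>r k\<close>.\<close>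
    define r where "r k = 1 / real (Suc k)" for k
    have r_pos: "r k > 0" for k by (simp add: r_def)
    have r_less: "r j < r i" if "i < j" for i j using that by (simp add: r_def divide_simps)
    have r_le: "r j \<le> r i" if "i \<le> j" for i j using that by (simp add: r_def divide_simps)
    have r_lim: "r \<longlonglongrightarrow> 0" unfolding r_def by (rule LIMSEQ_Suc[OF lim_1_over_n])
    define E' where "E' n = {x\<in>E. r n \<le> infdist x A}" for n
    define S where "S k = {x\<in>E. r (Suc k) \<le> infdist x A \<and> infdist x A < r k}" for k
    have dist_le: "infdist x A - infdist y A \<le> dist x y" for x y
      using infdist_triangle[of x A y] by simp
    \<comment> \<open>Every second shell, with \<open>c\<close> as the parity: between two of them lies a full shell, which separates them.\<close>
    have part: "(\<Sum>i. hausdorff1_outer (S (2 * i + c))) \<le> hausdorff1_outer E" for c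
    proof -
      have "(\<Sum>i. hausdorff1_outer (S (2 * i + c))) \<le> hausdorff1_outer (\<Union>i. S (2 * i + c))"
      proof (rule hausdorff1_outer_separated_sum)
        fix i j :: nat assume "i < j"
        define d where "d = r (Suc (2 * i + c)) - r (2 * j + c)"
        have "d > 0" unfolding d_def using \<open>i < j\<close> r_less[of "Suc (2 * i + c)" "2 * j + c"] by simp
        moreover have "d \<le> dist x y" if "k \<ge> j" "x \<in> S (2 * i + c)" "y \<in> S (2 * k + c)" for k x y
        proof -
          have "infdist y A < r (2 * j + c)"
            using that r_le[of "2 * j + c" "2 * k + c"] by (simp add: S_def)
          then show ?thesis using that dist_le[of x y] by (simp add: S_def d_def)
        qed
        ultimately show "\<exists>d>0. \<forall>k\<ge>j. \<forall>x\<in>S (2 * i + c). \<forall>y\<in>S (2 * k + c). d \<le> dist x y"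
          by blast
      qed
      also have "\<dots> \<le> hausdorff1_outer E" by (rule hausdorff1_outer_mono) (auto simp: S_def)
      finally show ?thesis .
    qed
    show "hausdorff1_outer (A \<inter> E) + hausdorff1_outer ((UNIV - A) \<inter> E) \<le> hausdorff1_outer E"
    proof (cases "hausdorff1_outer E = \<infinity>")
      case False
      define s where "s k = hausdorff1_outer (S k)" for k
      have "(\<Sum>k<n. s k) \<le> 2 * hausdorff1_outer E" for n
      proof -
        have "(\<Sum>k<n. s k) \<le> (\<Sum>k<2*n. s k)"
          by (rule sum_mono2) auto
        also have "\<dots> = (\<Sum>i<n. s (2*i)) + (\<Sum>i<n. s (2*i+1))"
          by (induction n) (auto simp: algebra_simps)
        also have "\<dots> \<le> hausdorff1_outer E + hausdorff1_outer E"
          using part[of 0] part[of 1] unfolding s_def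
          by (intro add_mono order_trans[OF sum_le_suminf[OF summableI]]) auto
        finally show ?thesis by (simp add: mult_2)
      qed
      then have "(\<Sum>k. s k) \<le> 2 * hausdorff1_outer E"
        by (intro suminf_le_const[OF summableI])
      then have fin: "(\<Sum>k. s k) \<noteq> \<infinity>"
        using False by (auto simp: top_unique ennreal_mult_eq_top_iff)
      have bound: "hausdorff1_outer (A \<inter> E) + hausdorff1_outer ((UNIV - A) \<inter> E)
          \<le> hausdorff1_outer E + (\<Sum>k. s (k + n))" for n
      proof -
        have "(UNIV - A) \<inter> E \<subseteq> E' n \<union> (\<Union>k. S (k + n))"
        proof
          fix x assume x: "x \<in> (UNIV - A) \<inter> E"
          then have pos: "infdist x A > 0"
            using in_closed_iff_infdist_zero[OF assms ne, of x] infdist_nonneg[of x A] by force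
          show "x \<in> E' n \<union> (\<Union>k. S (k + n))"
          proof (cases "r n \<le> infdist x A")
            case True then show ?thesis using x by (auto simp: E'_def)
          next
            case less: False
            have "\<exists>m. r m \<le> infdist x A"
              using order_tendstoD(2)[OF r_lim pos] by (auto simp: eventually_sequentially intro: less_imp_le)
            then obtain m where m: "r m \<le> infdist x A" "\<And>i. i < m \<Longrightarrow> \<not> r i \<le> infdist x A"
              using exists_least_iff[of "\<lambda>m. r m \<le> infdist x A"] by blast
            have "m > n" using m(1) less r_le[of m n] by (meson not_le order_trans)
            then obtain k where k: "m = Suc (k + n)"
              by (metis add.commute less_iff_Suc_add)
            then have "x \<in> S (k + n)" using m x by (auto simp: S_def not_le)
            then show ?thesis by blast
          qed
        qed
        then have "hausdorff1_outer ((UNIV - A) \<inter> E) \<le> hausdorff1_outer (E' n \<union> (\<Union>k. S (k + n)))"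
          by (rule hausdorff1_outer_mono)
        also have "\<dots> \<le> hausdorff1_outer (E' n) + hausdorff1_outer (\<Union>k. S (k + n))"
          by (rule hausdorff1_outer_Un)
        also have "\<dots> \<le> hausdorff1_outer (E' n) + (\<Sum>k. s (k + n))"
          unfolding s_def by (intro add_left_mono hausdorff1_outer_countably_subadditive)
        finally have 1: "hausdorff1_outer ((UNIV - A) \<inter> E) \<le> hausdorff1_outer (E' n) + (\<Sum>k. s (k + n))" .
        have "hausdorff1_outer (A \<inter> E) + hausdorff1_outer (E' n) \<le> hausdorff1_outer (A \<inter> E \<union> E' n)"
        proof (rule hausdorff1_outer_separated[OF r_pos[of n]])
          fix x y assume "x \<in> A \<inter> E" "y \<in> E' n"
          then show "r n \<le> dist x y"
            using infdist_le[of x A y] by (simp add: E'_def dist_commute)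
        qed
        also have "\<dots> \<le> hausdorff1_outer E" by (rule hausdorff1_outer_mono) (auto simp: E'_def)
        finally have 2: "hausdorff1_outer (A \<inter> E) + hausdorff1_outer (E' n) \<le> hausdorff1_outer E" .
        have "hausdorff1_outer (A \<inter> E) + hausdorff1_outer ((UNIV - A) \<inter> E)
            \<le> (hausdorff1_outer (A \<inter> E) + hausdorff1_outer (E' n)) + (\<Sum>k. s (k + n))"
          using add_left_mono[OF 1, of "hausdorff1_outer (A \<inter> E)"] by (simp only: add.assoc)
        also have "\<dots> \<le> hausdorff1_outer E + (\<Sum>k. s (k + n))"
          by (rule add_right_mono[OF 2])
        finally show ?thesis .
      qed
      \<comment> \<open>The tail of a convergent series, computed in the reals.\<close>
      have "(\<lambda>n. \<Sum>k. s (k + n)) \<longlonglongrightarrow> 0"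
      proof -
        define u where "u k = enn2real (s k)" for k
        have "s k < \<infinity>" for k
          by (rule ennreal_suminf_lessD) (use fin in \<open>simp add: less_top\<close>)
        then have u: "s k = ennreal (u k)" "0 \<le> u k" for k
          by (auto simp: u_def less_top)
        have "summable u"
          by (rule summable_suminf_not_top) (use u fin in auto)
        then have "(\<lambda>n. \<Sum>k. u (k + n)) \<longlonglongrightarrow> 0"
          by (rule suminf_exist_split2)
        then have "(\<lambda>n. ennreal (\<Sum>k. u (k + n))) \<longlonglongrightarrow> ennreal 0"
          by (rule tendsto_ennrealI)
        moreover have "ennreal (\<Sum>k. u (k + n)) = (\<Sum>k. s (k + n))" for n
          unfolding u(1) by (rule suminf_ennreal2[symmetric])
            (use \<open>summable u\<close> u(2) summable_ignore_initial_segment in auto)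
        ultimately show ?thesis by simp
      qed
      then have "(\<lambda>n. hausdorff1_outer E + (\<Sum>k. s (k + n))) \<longlonglongrightarrow> hausdorff1_outer E + 0"
        by (intro tendsto_add tendsto_const)
      then show ?thesis
        by (intro LIMSEQ_le_const[where X="\<lambda>n. hausdorff1_outer E + (\<Sum>k. s (k + n))"]) (use bound in auto)
    qed auto
  qed
  then show ?thesis by (auto simp: lambda_system_def)
qed

text \<open>
  The measure in the definition is given by an outer measure that must be shown to be additive on the
  Borel sets; otherwise \<^const>\<open>measure_of\<close> would yield the null measure.
\<close>

lemma emeasure_hausdorff1:
  assumes "A \<in> sets borel"
  shows "emeasure hausdorff1 A = hausdorff1_outer (A :: 'a::metric_space set)"
proof -
  let ?L = "lambda_system UNIV UNIV (hausdorff1_outer :: 'a set \<Rightarrow> ennreal)"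
  have "sigma_algebra UNIV (UNIV :: 'a set set)"
    using sigma_algebra_Pow[of "UNIV :: 'a set"] unfolding Pow_UNIV .
  then have L: "measure_space UNIV ?L hausdorff1_outer"
    by (rule sigma_algebra.caratheodory_lemma) (rule outer_measure_space_hausdorff1)
  have "sigma_sets UNIV {S :: 'a set. closed S} \<subseteq> ?L"
  proof (rule sigma_algebra.sigma_sets_subset)
    show "sigma_algebra UNIV ?L" using L by (simp add: measure_space_def)
  qed (auto simp: closed_in_lambda_system_hausdorff1)
  then have "sets borel \<subseteq> ?L" by (simp add: borel_eq_closed)
  then have "measure_space UNIV (sets borel) (hausdorff1_outer :: 'a set \<Rightarrow> ennreal)"
    using L sets.sigma_algebra_axioms[of "borel :: 'a measure"]
    unfolding measure_space_def positive_def countably_additive_def space_borel by blast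
  then show ?thesis unfolding hausdorff1_def
    using assms by (intro emeasure_measure_of_sigma) (auto simp: measure_space_def)
qed

lemma sets_hausdorff1 [simp, measurable_cong]: "sets hausdorff1 = sets borel"
  using sets.sigma_sets_eq[of borel] unfolding hausdorff1_def by simp

lemma space_hausdorff1 [simp]: "space hausdorff1 = UNIV"
  unfolding hausdorff1_def by (simp add: space_measure_of_conv)

section \<open>Hausdorff measure and length\<close>

lemma emeasure_hausdorff1_le:
  assumes "A \<in> sets borel" "\<And>\<delta>. \<delta> > 0 \<Longrightarrow> hausdorff1_pre \<delta> A \<le> c"
  shows "emeasure hausdorff1 A \<le> c"
  unfolding emeasure_hausdorff1[OF assms(1)] hausdorff1_outer_def by (rule SUP_least) (use assms(2) in auto)

lemma emeasure_hausdorff1_singleton [simp]: "emeasure hausdorff1 {x} = 0"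
proof -
  have "emeasure hausdorff1 {x} \<le> 0"
  proof (rule emeasure_hausdorff1_le)
    show "hausdorff1_pre \<delta> {x} \<le> 0" if "\<delta> > 0" for \<delta>
      using hausdorff1_pre_le[of "{x}" "\<lambda>_. {x}" \<delta>] that by simp
  qed auto
  then show ?thesis by simp
qed

text \<open>
  The function \<open>\<Phi>\<close> stands for the length of the path up to a given parameter. A subdivision into
  equal parameter intervals covers the path by sets whose diameters are bounded by the increments of
  \<open>\<Phi>\<close>, and these sum up to \<open>\<Phi> b - \<Phi> a\<close>; uniform continuity makes them all small.
\<close>

lemma emeasure_hausdorff1_path_le:
  fixes \<gamma> :: "real \<Rightarrow> 'a::metric_space"
  assumes "a \<le> b" and cont: "continuous_on {a..b} \<gamma>" "continuous_on {a..b} \<Phi>"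
    and dist_le: "\<And>s t. a \<le> s \<Longrightarrow> s \<le> t \<Longrightarrow> t \<le> b \<Longrightarrow> dist (\<gamma> s) (\<gamma> t) \<le> \<Phi> t - \<Phi> s"
  shows "emeasure hausdorff1 (\<gamma> ` {a..b}) \<le> ennreal (\<Phi> b - \<Phi> a)"
proof (rule emeasure_hausdorff1_le)
  show "\<gamma> ` {a..b} \<in> sets borel"
    by (intro borel_compact compact_continuous_image cont) simp
  have mono: "\<Phi> s \<le> \<Phi> t" if "a \<le> s" "s \<le> t" "t \<le> b" for s t
    using dist_le[OF that] zero_le_dist[of "\<gamma> s" "\<gamma> t"] by linarith
  fix \<delta> :: real assume "\<delta> > 0"
  have "uniformly_continuous_on {a..b} \<Phi>"
    by (rule compact_uniformly_continuous[OF cont(2)]) simp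
  then obtain d where d: "d > 0" "\<And>s t. s \<in> {a..b} \<Longrightarrow> t \<in> {a..b} \<Longrightarrow> dist t s < d \<Longrightarrow> dist (\<Phi> t) (\<Phi> s) < \<delta>"
    using \<open>\<delta> > 0\<close> unfolding uniformly_continuous_on_def by metis
  obtain n :: nat where n: "(b - a) / d < real n" using reals_Archimedean2 by blast
  have "n > 0" using n d(1) \<open>a \<le> b\<close> by (cases n) (auto simp: field_simps)
  have step: "(b - a) / n < d" using n d(1) \<open>n > 0\<close> by (simp add: field_simps)
  define p where "p i = a + real i * ((b - a) / n)" for i
  have p0: "p 0 = a" and pn: "p n = b" using \<open>n > 0\<close> by (auto simp: p_def)
  have p_mono: "p i \<le> p j" if "i \<le> j" for i j
    using that \<open>a \<le> b\<close> unfolding p_def by (intro add_left_mono mult_right_mono) auto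
  have p_in: "a \<le> p i" "i \<le> n \<Longrightarrow> p i \<le> b" for i
    using p_mono[of 0 i] p_mono[of i n] by (auto simp: p0 pn)
  define C where "C i = (if i < n then \<gamma> ` {p i..p (Suc i)} else {})" for i
  have diam: "diameter (C i) \<le> \<Phi> (p (Suc i)) - \<Phi> (p i)" if "i < n" for i
  proof -
    have "dist (\<gamma> s) (\<gamma> t) \<le> \<Phi> (p (Suc i)) - \<Phi> (p i)"
      if "s \<in> {p i..p (Suc i)}" "t \<in> {p i..p (Suc i)}" "s \<le> t" for s t
    proof -
      have b: "a \<le> s" "t \<le> b" "a \<le> p i" "p (Suc i) \<le> b"
        using that p_in[of i] p_in[of "Suc i"] \<open>i < n\<close> by auto
      show ?thesis
        using dist_le[of s t] mono[of "p i" s] mono[of t "p (Suc i)"] b that by auto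
    qed
    then have "dist x y \<le> \<Phi> (p (Suc i)) - \<Phi> (p i)" if "x \<in> C i" "y \<in> C i" for x y
      using that \<open>i < n\<close> by (auto simp: C_def) (metis atLeastAtMost_iff dist_commute linear)
    then show ?thesis
      unfolding diameter_def using \<open>i < n\<close> p_mono[of i "Suc i"] mono[of "p i" "p (Suc i)"] p_in[of i] p_in[of "Suc i"]
      by (auto intro!: cSUP_least)
  qed
  have "hausdorff1_pre \<delta> (\<gamma> ` {a..b}) \<le> (\<Sum>i. ennreal (diameter (C i)))"
  proof (rule hausdorff1_pre_le)
    have "\<exists>i<n. t \<in> {p i..p (Suc i)}" if "t \<in> {a..b}" for t
    proof (cases "t = b")
      case True
      then show ?thesis using \<open>n > 0\<close> pn p_mono[of "n - 1" n] by (intro exI[of _ "n - 1"]) auto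
    next
      case False
      then have "\<not> p n \<le> t" "p 0 \<le> t" using that by (auto simp: p0 pn)
      then obtain k where "k < n" "p k \<le> t" "\<not> p (Suc k) \<le> t"
        using ex_least_nat_less[of "\<lambda>i. \<not> p i \<le> t" n] by fastforce
      then show ?thesis by auto
    qed
    then show "\<gamma> ` {a..b} \<subseteq> (\<Union>i. C i)" by (fastforce simp: C_def)
    show "bounded (C i)" for i
    proof (cases "i < n")
      case True
      then have "{p i..p (Suc i)} \<subseteq> {a..b}" using p_in[of i] p_in[of "Suc i"] by auto
      then have "compact (\<gamma> ` {p i..p (Suc i)})"
        by (intro compact_continuous_image continuous_on_subset[OF cont(1)]) auto
      then show ?thesis using True by (simp add: C_def compact_imp_bounded)
    qed (simp add: C_def)
    show "diameter (C i) \<le> \<delta>" for i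
    proof (cases "i < n")
      case True
      have "p (Suc i) - p i = (b - a) / n"
        by (simp add: p_def distrib_right add_divide_distrib)
      then have "dist (p (Suc i)) (p i) < d"
        using step \<open>a \<le> b\<close> by (simp add: dist_real_def)
      then have "\<Phi> (p (Suc i)) - \<Phi> (p i) < \<delta>"
        using d(2)[of "p i" "p (Suc i)"] p_in[of i] p_in[of "Suc i"] True by (auto simp: dist_real_def)
      then show ?thesis using diam[OF True] by linarith
    qed (use \<open>\<delta> > 0\<close> in \<open>simp add: C_def\<close>)
  qed
  also have "\<dots> = (\<Sum>i<n. ennreal (diameter (C i)))"
    by (rule suminf_finite) (auto simp: C_def)
  also have "\<dots> \<le> (\<Sum>i<n. ennreal (\<Phi> (p (Suc i)) - \<Phi> (p i)))"
    by (intro sum_mono ennreal_leI diam) auto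
  also have "\<dots> = ennreal (\<Sum>i<n. \<Phi> (p (Suc i)) - \<Phi> (p i))"
    by (rule sum_ennreal) (use mono p_mono p_in in \<open>auto simp: Suc_le_eq\<close>)
  also have "(\<Sum>i<n. \<Phi> (p (Suc i)) - \<Phi> (p i)) = \<Phi> b - \<Phi> a"
    by (subst sum_lessThan_telescope) (simp add: p0 pn)
  finally show "hausdorff1_pre \<delta> (\<gamma> ` {a..b}) \<le> ennreal (\<Phi> b - \<Phi> a)" .
qed

text \<open>
  The function \<open>dist x\<close> does not increase distances and maps the connected set \<open>S\<close> onto a set containing
  the interval from \<open>0\<close> to \<open>dist x y\<close>. Every cover of \<open>S\<close> therefore yields a cover of that interval by
  intervals no longer than the diameters, and the Lebesgue measure of the interval is its length.
\<close>

lemma hausdorff1_outer_connected_ge: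
  fixes S :: "'a::metric_space set"
  assumes S: "connected S" "x \<in> S" "y \<in> S"
  shows "ennreal (dist x y) \<le> hausdorff1_outer S"
proof -
  have "ennreal (dist x y) \<le> hausdorff1_pre 1 S"
    unfolding hausdorff1_pre_def
  proof (rule INF_greatest)
    fix C :: "nat \<Rightarrow> 'a set" assume "C \<in> {C. S \<subseteq> (\<Union>i. C i) \<and> (\<forall>i. bounded (C i) \<and> diameter (C i) \<le> 1)}"
    then have cover: "S \<subseteq> (\<Union>i. C i)" and bd: "\<And>i. bounded (C i)" by auto
    define I where "I i = (if C i = {} then {} else {Inf (dist x ` C i)..Sup (dist x ` C i)})" for i
    have I: "dist x ` C i \<subseteq> I i \<and> emeasure lborel (I i) \<le> ennreal (diameter (C i))" for i
    proof (cases "C i = {}")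
      case False
      have diff: "dist x u \<le> diameter (C i) + dist x v" if "u \<in> C i" "v \<in> C i" for u v
        using diameter_bounded_bound[OF bd that] dist_triangle[of x u v] by (simp add: dist_commute)
      obtain v where v: "v \<in> C i" using False by blast
      have bdd: "bdd_above (dist x ` C i)" "bdd_below (dist x ` C i)"
        by (rule bdd_aboveI2[of _ _ "diameter (C i) + dist x v"], use diff v in blast)
           (rule bdd_belowI2[of _ 0], simp)
      have "Sup (dist x ` C i) - diameter (C i) \<le> dist x v" if "v \<in> C i" for v
        using cSUP_least[OF False, of "dist x" "diameter (C i) + dist x v"] diff that by auto
      then have "Sup (dist x ` C i) - diameter (C i) \<le> Inf (dist x ` C i)"
        using False by (intro cINF_greatest) auto
      moreover have "Inf (dist x ` C i) \<le> Sup (dist x ` C i)"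
        using False bdd by (meson cINF_lower cSUP_upper order_trans v)
      ultimately show ?thesis
        using False bdd by (auto simp: I_def intro!: cINF_lower cSUP_upper ennreal_leI)
    qed (simp add: I_def)
    have I_borel: "I i \<in> sets borel" for i by (simp add: I_def)
    have "connected (dist x ` S)"
      by (intro connected_continuous_image S continuous_intros)
    then have "{0..dist x y} \<subseteq> dist x ` S"
      using S by (intro connected_contains_Icc) (auto intro: rev_image_eqI)
    also have "\<dots> \<subseteq> (\<Union>i. I i)" using cover I by blast
    finally have "emeasure lborel {0..dist x y} \<le> emeasure lborel (\<Union>i. I i)"
      by (rule emeasure_mono) (use I_borel in auto)
    also have "\<dots> \<le> (\<Sum>i. emeasure lborel (I i))"
      by (rule emeasure_subadditive_countably) (use I_borel in auto)
    also have "\<dots> \<le> (\<Sum>i. ennreal (diameter (C i)))"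
      using I by (intro suminf_le) auto
    finally show "ennreal (dist x y) \<le> (\<Sum>i. ennreal (diameter (C i)))" by simp
  qed
  also have "\<dots> \<le> hausdorff1_outer S" by (rule hausdorff1_pre_le_outer) simp
  finally show ?thesis .
qed

lemma has_vector_derivative_quotient:
  assumes "(f has_vector_derivative D) (at x within S)"
  shows "((\<lambda>t. (f t - f x) /\<^sub>R (t - x)) \<longlongrightarrow> D) (at x within S)"
proof -
  have "((\<lambda>t. norm ((1 / norm (t - x)) *\<^sub>R (f t - (f x + (t - x) *\<^sub>R D)))) \<longlongrightarrow> 0) (at x within S)"
    using assms unfolding has_vector_derivative_def has_derivative_within
    by (intro tendsto_norm_zero) (rule conjunct2)
  moreover have "norm ((1 / norm (t - x)) *\<^sub>R (f t - (f x + (t - x) *\<^sub>R D)))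
      = norm ((f t - f x) /\<^sub>R (t - x) - D)" if "t \<noteq> x" for t
  proof -
    have "(f t - f x) /\<^sub>R (t - x) - D = (f t - (f x + (t - x) *\<^sub>R D)) /\<^sub>R (t - x)"
      using that by (simp add: scaleR_diff_right scaleR_add_right)
    then show ?thesis by (simp add: divide_inverse)
  qed
  ultimately have "((\<lambda>t. norm ((f t - f x) /\<^sub>R (t - x) - D)) \<longlongrightarrow> 0) (at x within S)"
    by (elim Lim_transform_eventually) (auto simp: eventually_at_filter)
  then show ?thesis
    using tendsto_norm_zero_iff[of "\<lambda>t. (f t - f x) /\<^sub>R (t - x) - D"] by (simp add: LIM_zero_iff)
qed

section \<open>Parametrized closed curves\<close>

text \<open>
  The parametrizations of \<^const>\<open>closed_C1_curve\<close>. Moving the starting point (lemma \<open>shift\<close> below)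
  gives another parametrization of the same curve, so that statements about a general point of the
  curve reduce to statements about the point \<open>\<gamma> 0\<close>.
\<close>

locale closed_C1_param =
  fixes \<gamma> :: "real \<Rightarrow> 'a::euclidean_space"
  assumes C1: "\<gamma> C1_differentiable_on UNIV"
    and regular: "\<And>t. vector_derivative \<gamma> (at t) \<noteq> 0"
    and periodic: "\<And>t. \<gamma> (t + 1) = \<gamma> t"
    and inj: "inj_on \<gamma> {0..<1}"
begin

abbreviation V :: "real \<Rightarrow> 'a" where "V t \<equiv> vector_derivative \<gamma> (at t)"

lemma has_velocity: "(\<gamma> has_vector_derivative V t) (at t within S)"
  using C1 unfolding C1_differentiable_on_eq
  by (meson UNIV_I has_vector_derivative_at_within vector_derivative_works)

lemma continuous_velocity: "continuous_on S V"
  using C1 unfolding C1_differentiable_on_eq by (meson continuous_on_subset top_greatest)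

lemma continuous_curve: "continuous_on S \<gamma>"
  using C1_differentiable_imp_continuous_on[OF C1] by (meson continuous_on_subset top_greatest)

lemma curve_add_int: "\<gamma> (t + of_int n) = \<gamma> t"
proof (induction n)
  case (nonneg n)
  then show ?case
  proof (induction n)
    case (Suc n)
    then show ?case using periodic[of "t + real n"] by (simp add: algebra_simps)
  qed simp
next
  case (neg n)
  show ?case
  proof (induction n)
    case 0
    show ?case using periodic[of "t - 1"] by simp
  next
    case (Suc n)
    then show ?case using periodic[of "t - real (Suc (Suc n))"] by (simp add: algebra_simps)
  qed
qed

lemma curve_frac: "\<gamma> (frac t) = \<gamma> t"
  using curve_add_int[of "frac t" "\<lfloor>t\<rfloor>"] by (simp add: frac_def)

lemma curve_eq_iff: "\<gamma> s = \<gamma> t \<longleftrightarrow> s - t \<in> \<int>"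
proof
  assume "\<gamma> s = \<gamma> t"
  then have "frac s = frac t"
    using inj_onD[OF inj, of "frac s" "frac t"] by (simp add: curve_frac frac_lt_1)
  then have "s - t = of_int (\<lfloor>s\<rfloor> - \<lfloor>t\<rfloor>)" by (simp add: frac_def)
  then show "s - t \<in> \<int>" by (metis Ints_of_int)
next
  assume "s - t \<in> \<int>"
  then obtain n where "s = t + of_int n" by (auto elim!: Ints_cases simp: algebra_simps)
  then show "\<gamma> s = \<gamma> t" by (simp add: curve_add_int)
qed

lemma curve_neq:
  assumes "0 < \<bar>s - t\<bar>" "\<bar>s - t\<bar> < 1" shows "\<gamma> s \<noteq> \<gamma> t"
proof
  assume "\<gamma> s = \<gamma> t"
  then have "1 \<le> \<bar>s - t\<bar>"
    using assms(1) by (intro Ints_nonzero_abs_ge1) (auto simp: curve_eq_iff)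
  then show False using assms(2) by linarith
qed

lemma range_curve: "range \<gamma> = \<gamma> ` {0..<1}"
proof -
  have "\<gamma> t \<in> \<gamma> ` {0..<1}" for t
    by (rule image_eqI[of _ _ "frac t"]) (auto simp: curve_frac frac_lt_1)
  then show ?thesis by auto
qed

lemma range_curve_closed_interval: "range \<gamma> = \<gamma> ` {0..1}"
proof
  show "range \<gamma> \<subseteq> \<gamma> ` {0..1}" unfolding range_curve by (rule image_mono) auto
qed auto

lemma compact_curve: "compact (range \<gamma>)"
  unfolding range_curve_closed_interval by (intro compact_continuous_image continuous_curve) simp

lemma has_velocity_shift: "((\<lambda>t. \<gamma> (s + t)) has_vector_derivative V (s + t)) (at t)"
proof -
  have "((\<lambda>t. s + t) has_vector_derivative 0 + 1) (at t)"
    by (rule has_vector_derivative_add) simp_all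
  then show ?thesis
    using vector_diff_chain_at[of "\<lambda>t. s + t" 1 t \<gamma> "V (s + t)"] has_velocity[of "s + t" UNIV]
    by (simp add: o_def)
qed

lemma velocity_shift: "vector_derivative (\<lambda>t. \<gamma> (s + t)) (at t) = V (s + t)"
  by (rule vector_derivative_at[OF has_velocity_shift])

lemma shift: "closed_C1_param (\<lambda>t. \<gamma> (s + t))"
proof
  have "continuous_on UNIV (\<lambda>t. V (s + t))"
    by (intro continuous_on_compose2[OF continuous_velocity[of UNIV]] continuous_intros) auto
  then show "(\<lambda>t. \<gamma> (s + t)) C1_differentiable_on UNIV"
    unfolding C1_differentiable_on_def by (intro exI[of _ "\<lambda>t. V (s + t)"] conjI ballI has_velocity_shift)
  show "vector_derivative (\<lambda>t. \<gamma> (s + t)) (at t) \<noteq> 0" for t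
    using regular by (simp add: velocity_shift)
  show "\<gamma> (s + (t + 1)) = \<gamma> (s + t)" for t using periodic[of "s + t"] by (simp add: add.assoc)
  show "inj_on (\<lambda>t. \<gamma> (s + t)) {0..<1}"
  proof (rule inj_onI)
    fix t u :: real assume "t \<in> {0..<1}" "u \<in> {0..<1}" "\<gamma> (s + t) = \<gamma> (s + u)"
    then show "t = u" using curve_neq[of "s + t" "s + u"] by fastforce
  qed
qed

lemma range_shift: "range (\<lambda>t. \<gamma> (s + t)) = range \<gamma>"
proof -
  have "\<gamma> t \<in> range (\<lambda>t. \<gamma> (s + t))" for t by (rule image_eqI[of _ _ "t - s"]) auto
  then show ?thesis by auto
qed

definition arc_length :: "real \<Rightarrow> real" where "arc_length t = integral {0..t} (\<lambda>u. norm (V u))"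

lemma continuous_speed: "continuous_on S (\<lambda>u. norm (V u))"
  by (intro continuous_intros continuous_velocity)

lemma arc_length_has_derivative:
  "t \<in> {0..1} \<Longrightarrow> (arc_length has_real_derivative norm (V t)) (at t within {0..1})"
  unfolding arc_length_def by (rule integral_has_real_derivative[OF continuous_speed])

lemma continuous_arc_length: "continuous_on {0..1} arc_length"
  by (rule DERIV_continuous_on) (rule arc_length_has_derivative)

lemma arc_length_diff: "0 \<le> s \<Longrightarrow> s \<le> t \<Longrightarrow> arc_length t - arc_length s = integral {s..t} (\<lambda>u. norm (V u))"
  unfolding arc_length_def
  using Henstock_Kurzweil_Integration.integral_combine[of 0 s t "\<lambda>u. norm (V u)"]
  by (simp add: integrable_continuous_real continuous_speed algebra_simps)

lemma dist_curve_le: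
  assumes "0 \<le> s" "s \<le> t" shows "dist (\<gamma> s) (\<gamma> t) \<le> arc_length t - arc_length s"
proof -
  have I: "(V has_integral (\<gamma> t - \<gamma> s)) {s..t}"
    using assms by (intro fundamental_theorem_of_calculus has_velocity)
  have "norm (\<gamma> t - \<gamma> s) \<le> integral {s..t} (\<lambda>u. norm (V u))"
    unfolding integral_unique[OF I, symmetric]
    by (intro integral_norm_bound_integral integrable_continuous_real continuous_speed continuous_velocity) auto
  then show ?thesis using arc_length_diff assms by (simp add: dist_norm norm_minus_commute)
qed

lemma curve_image_borel: "\<gamma> ` {s..t} \<in> sets borel"
  by (intro borel_compact compact_continuous_image continuous_curve) simp

lemma emeasure_curve_le:
  "0 \<le> s \<Longrightarrow> s \<le> t \<Longrightarrow> t \<le> 1 \<Longrightarrow> emeasure hausdorff1 (\<gamma> ` {s..t}) \<le> ennreal (arc_length t - arc_length s)"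
  by (intro emeasure_hausdorff1_path_le continuous_curve dist_curve_le
      continuous_on_subset[OF continuous_arc_length]) simp_all

text \<open>
  The measure of an arc lies between its chord and its length. Both bounds have the same derivative
  \<open>\<bar>\<gamma>'\<bar>\<close> along the curve, which pins down the measure in lemma \<open>measure_curve\<close>.
\<close>

lemma measure_curve_bounds:
  assumes "0 \<le> s" "s \<le> t" "t \<le> 1"
  shows "emeasure hausdorff1 (\<gamma> ` {s..t}) = ennreal (measure hausdorff1 (\<gamma> ` {s..t}))"
    and "dist (\<gamma> s) (\<gamma> t) \<le> measure hausdorff1 (\<gamma> ` {s..t})"
    and "measure hausdorff1 (\<gamma> ` {s..t}) \<le> arc_length t - arc_length s"
proof -
  show e: "emeasure hausdorff1 (\<gamma> ` {s..t}) = ennreal (measure hausdorff1 (\<gamma> ` {s..t}))"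
    using emeasure_curve_le[OF assms] by (intro emeasure_eq_ennreal_measure) (auto simp: top_unique)
  have "ennreal (dist (\<gamma> s) (\<gamma> t)) \<le> emeasure hausdorff1 (\<gamma> ` {s..t})"
    unfolding emeasure_hausdorff1[OF curve_image_borel]
    using assms by (intro hausdorff1_outer_connected_ge connected_continuous_image continuous_curve) auto
  then show "dist (\<gamma> s) (\<gamma> t) \<le> measure hausdorff1 (\<gamma> ` {s..t})"
    unfolding e by (subst (asm) ennreal_le_iff) simp_all
  have "0 \<le> arc_length t - arc_length s" using dist_curve_le[OF assms(1,2)] zero_le_dist[of "\<gamma> s" "\<gamma> t"] by linarith
  then show "measure hausdorff1 (\<gamma> ` {s..t}) \<le> arc_length t - arc_length s"
    using emeasure_curve_le[OF assms] unfolding e by (subst (asm) ennreal_le_iff)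
qed

text \<open>
  For \<open>s = 0\<close> the point \<open>\<gamma> 1 = \<gamma> 0\<close> lies on both arcs, since the curve closes up.
\<close>

lemma curve_images_Int:
  assumes "0 \<le> s" "s \<le> t" "t \<le> 1"
  shows "\<gamma> ` {s..t} \<inter> \<gamma> ` {t..1} \<subseteq> {\<gamma> t, \<gamma> 1}"
    proof
      fix x assume "x \<in> \<gamma> ` {s..t} \<inter> \<gamma> ` {t..1}"
      then obtain u v where uv: "u \<in> {s..t}" "v \<in> {t..1}" "x = \<gamma> u" "x = \<gamma> v"
        by (elim IntE imageE)
      have "\<gamma> v = \<gamma> u" using uv(3) unfolding uv(4) .
      then have "\<not> (0 < \<bar>v - u\<bar> \<and> \<bar>v - u\<bar> < 1)" using curve_neq[of v u] by blast
      moreover have "s \<le> u" "u \<le> t" "t \<le> v" "v \<le> 1" using uv(1,2) by auto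
      ultimately have "u = t \<or> v = 1" using assms by linarith
      then show "x \<in> {\<gamma> t, \<gamma> 1}" using uv(3,4) by blast
    qed

lemma curve_images_null:
  assumes "0 \<le> s" "s \<le> t" "t \<le> 1"
  shows "\<gamma> ` {s..t} \<inter> \<gamma> ` {t..1} \<in> null_sets hausdorff1"
proof (rule null_sets_subset[OF _ _ curve_images_Int[OF assms]])
    have "{\<gamma> t} \<union> {\<gamma> 1} \<in> null_sets hausdorff1" by (intro null_sets.Un) (auto simp: null_sets_def)
    then show "{\<gamma> t, \<gamma> 1} \<in> null_sets hausdorff1" by (simp add: insert_commute)
    show "\<gamma> ` {s..t} \<inter> \<gamma> ` {t..1} \<in> sets hausdorff1"
      by (simp add: sets.Int curve_image_borel)
  qed

lemma measure_curve_split: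
  assumes "0 \<le> s" "s \<le> t" "t \<le> 1"
  shows "measure hausdorff1 (\<gamma> ` {s..1}) = measure hausdorff1 (\<gamma> ` {s..t}) + measure hausdorff1 (\<gamma> ` {t..1})"
proof -
  note null = curve_images_null[OF assms]
  have Un_Diff_Int_absorb: "A \<union> (B - A \<inter> B) = A \<union> B" for A B :: "'a set" by blast
  have "{s..1} = {s..t} \<union> {t..1}" using assms by auto
  then have "\<gamma> ` {s..1} = \<gamma> ` {s..t} \<union> \<gamma> ` {t..1}"
    by (metis image_Un)
  then have "emeasure hausdorff1 (\<gamma> ` {s..1})
      = emeasure hausdorff1 (\<gamma> ` {s..t} \<union> (\<gamma> ` {t..1} - \<gamma> ` {s..t} \<inter> \<gamma> ` {t..1}))"
    by (simp only: Un_Diff_Int_absorb)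
  also have "\<dots> = emeasure hausdorff1 (\<gamma> ` {s..t}) + emeasure hausdorff1 (\<gamma> ` {t..1} - \<gamma> ` {s..t} \<inter> \<gamma> ` {t..1})"
    by (rule plus_emeasure[symmetric]) (use curve_image_borel in auto)
  also have "emeasure hausdorff1 (\<gamma> ` {t..1} - \<gamma> ` {s..t} \<inter> \<gamma> ` {t..1}) = emeasure hausdorff1 (\<gamma> ` {t..1})"
    by (rule emeasure_Diff_null_set[OF null]) (use curve_image_borel in auto)
  finally show ?thesis
    using measure_curve_bounds(1) assms by (simp add: ennreal_plus[symmetric] del: ennreal_plus)
qed

text \<open>
  The function \<open>K\<close>, which is the measure of the arc from \<open>s\<close> to \<open>1\<close> plus the length of the arc from \<open>0\<close>
  to \<open>s\<close>, has derivative zero: by the preceding bounds its increments are at most the difference of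
  arc length and chord length.
\<close>

lemma measure_curve: "s \<in> {0..1} \<Longrightarrow> measure hausdorff1 (\<gamma> ` {s..1}) = arc_length 1 - arc_length s"
proof -
  define K where "K s = measure hausdorff1 (\<gamma> ` {s..1}) + arc_length s" for s
  define q where "q s t = (arc_length t - arc_length s) / (t - s)" for s t
  define d where "d s t = dist (\<gamma> t) (\<gamma> s) / \<bar>t - s\<bar>" for s t
  have K_le: "\<bar>K t - K s\<bar> \<le> \<bar>arc_length t - arc_length s\<bar> - dist (\<gamma> t) (\<gamma> s)" if "s \<in> {0..1}" "t \<in> {0..1}" for s t
  proof -
    have *: "\<bar>K t - K s\<bar> \<le> \<bar>arc_length t - arc_length s\<bar> - dist (\<gamma> t) (\<gamma> s)"
      if "0 \<le> s" "s \<le> t" "t \<le> 1" for s t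
      using measure_curve_split[OF that] measure_curve_bounds[OF that]
      unfolding K_def by (auto simp: dist_commute abs_if)
    show ?thesis
    proof (cases "s \<le> t")
      case True then show ?thesis using * that by auto
    next
      case False then show ?thesis using *[of t s] that by (auto simp: abs_minus_commute dist_commute)
    qed
  qed
  have "(K has_field_derivative 0) (at s within {0..1})" if s: "s \<in> {0..1}" for s
    unfolding has_field_derivative_iff
  proof (rule Lim_null_comparison)
    have "((\<lambda>t. norm ((\<gamma> t - \<gamma> s) /\<^sub>R (t - s))) \<longlongrightarrow> norm (V s)) (at s within {0..1})"
      by (intro tendsto_norm has_vector_derivative_quotient has_velocity)
    then have "(d s \<longlongrightarrow> norm (V s)) (at s within {0..1})"
      by (simp add: d_def[abs_def] dist_norm divide_inverse mult.commute)
    moreover have "(q s \<longlongrightarrow> norm (V s)) (at s within {0..1})"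
      using arc_length_has_derivative[OF s] by (simp add: has_field_derivative_iff q_def[abs_def])
    ultimately have "((\<lambda>t. \<bar>q s t\<bar> - d s t) \<longlongrightarrow> \<bar>norm (V s)\<bar> - norm (V s)) (at s within {0..1})"
      by (intro tendsto_intros)
    then show "((\<lambda>t. \<bar>q s t\<bar> - d s t) \<longlongrightarrow> 0) (at s within {0..1})" by simp
    have "norm ((K t - K s) / (t - s)) \<le> \<bar>q s t\<bar> - d s t" if "t \<in> {0..1}" "t \<noteq> s" for t
      using divide_right_mono[OF K_le[OF s that(1)], of "\<bar>t - s\<bar>"]
      unfolding q_def d_def norm_divide real_norm_def abs_divide diff_divide_distrib[of "\<bar>arc_length t - arc_length s\<bar>"]
      by simp
    then show "\<forall>\<^sub>F t in at s within {0..1}. norm ((K t - K s) / (t - s)) \<le> \<bar>q s t\<bar> - d s t"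
      by (auto simp: eventually_at_filter)
  qed
  then have "\<exists>c. \<forall>s\<in>{0..1}. K s = c"
    by (intro has_field_derivative_zero_constant) auto
  then have "K s = K 1" if "s \<in> {0..1}" for s using that by auto
  moreover have "measure hausdorff1 (\<gamma> ` {1..1}) = 0" by (simp add: measure_def)
  ultimately show "s \<in> {0..1} \<Longrightarrow> ?thesis" by (fastforce simp: K_def)
qed


lemma arc_length_mono: "0 \<le> s \<Longrightarrow> s \<le> t \<Longrightarrow> arc_length s \<le> arc_length t"
  using dist_curve_le[of s t] zero_le_dist[of "\<gamma> s" "\<gamma> t"] by linarith

lemma emeasure_curve: "s \<in> {0..1} \<Longrightarrow> emeasure hausdorff1 (\<gamma> ` {s..1}) = ennreal (arc_length 1 - arc_length s)"
  using measure_curve_bounds(1)[of s 1] measure_curve[of s] by simp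

lemma emeasure_range_curve: "emeasure hausdorff1 (range \<gamma>) = ennreal (arc_length 1)"
proof -
  have "arc_length 0 = 0" by (simp add: arc_length_def)
  then show ?thesis using emeasure_curve[of 0] by (simp add: range_curve_closed_interval)
qed

text \<open>
  The inverse of \<open>\<gamma>\<close> on one period, extended by \<open>0\<close> off the curve in order to be a Borel function on
  the whole space. It transports the Hausdorff measure on the curve to the parameter interval.
\<close>

definition param :: "'a \<Rightarrow> real" where
  "param x = (if x \<in> range \<gamma> then the_inv_into {0..<1} \<gamma> x else 0)"

lemma param_curve: "t \<in> {0..<1} \<Longrightarrow> param (\<gamma> t) = t"
  by (simp add: param_def the_inv_into_f_f[OF inj])

lemma curve_param:
  assumes "x \<in> range \<gamma>" shows "param x \<in> {0..<1}" "\<gamma> (param x) = x"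
proof -
  obtain t where "t \<in> {0..<1}" "x = \<gamma> t" using assms unfolding range_curve by blast
  then show "param x \<in> {0..<1}" "\<gamma> (param x) = x" using param_curve[of t] by auto
qed

lemma range_curve_borel: "range \<gamma> \<in> sets borel"
  by (rule borel_compact[OF compact_curve])

lemma param_greater: "{x \<in> range \<gamma>. a < param x} =
  (if a < 0 then range \<gamma> else if a < 1 then range \<gamma> - \<gamma> ` {0..a} else {})"
proof -
  have eq: "x \<in> \<gamma> ` {0..a} \<longleftrightarrow> param x \<le> a" if "x \<in> range \<gamma>" "0 \<le> a" "a < 1" for x
  proof
    assume "x \<in> \<gamma> ` {0..a}"
    then obtain t where "t \<in> {0..a}" "x = \<gamma> t" by blast
    then show "param x \<le> a" using param_curve[of t] that(3) by auto
  next
    assume "param x \<le> a"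
    then have "param x \<in> {0..a}" using curve_param[OF that(1)] by simp
    then have "\<gamma> (param x) \<in> \<gamma> ` {0..a}" by (rule imageI)
    then show "x \<in> \<gamma> ` {0..a}" unfolding curve_param(2)[OF that(1)] .
  qed
  show ?thesis
  proof (rule set_eqI)
    fix x
    show "x \<in> {x \<in> range \<gamma>. a < param x} \<longleftrightarrow>
      x \<in> (if a < 0 then range \<gamma> else if a < 1 then range \<gamma> - \<gamma> ` {0..a} else {})"
    proof (cases "x \<in> range \<gamma>")
      case True
      then show ?thesis using curve_param(1)[OF True] eq[OF True]
        by (cases "a < 0"; cases "a < 1") (simp_all add: not_le)
    qed simp
  qed
qed

lemma param_measurable: "param \<in> borel_measurable borel"
proof (rule borel_measurable_iff_greater[THEN iffD2], rule allI)
  fix a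
  have "{x \<in> range \<gamma>. a < param x} \<in> sets borel"
    unfolding param_greater using range_curve_borel curve_image_borel by (auto intro!: sets.Diff)
  moreover have "{x \<in> space borel. a < param x} =
      {x \<in> range \<gamma>. a < param x} \<union> (if a < 0 then - range \<gamma> else {})"
    by (auto simp: param_def)
  ultimately show "{x \<in> space borel. a < param x} \<in> sets borel"
    using range_curve_borel by auto
qed

text \<open>
  Finite measures on the line are determined by their values on the half-lines \<open>{a<..}\<close>, and these
  values are the measures of arcs.
\<close>

lemma distr_param_hausdorff1:
  "distr (density hausdorff1 (indicator (range \<gamma>))) borel param =
   density lborel (\<lambda>t. ennreal (norm (V t)) * indicator {0..1} t)" (is "?M = ?N")
proof (rule measure_eqI_lessThan)
  have param: "param \<in> measurable (density hausdorff1 (indicator (range \<gamma>))) borel"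
    using param_measurable by (simp cong: measurable_cong_sets)
  have V_meas: "(\<lambda>t. ennreal (norm (V t)) * indicator {0..1} t) \<in> borel_measurable lborel"
    using borel_measurable_continuous_onI[OF continuous_speed] by measurable
  have M: "emeasure ?M {a<..} = emeasure hausdorff1 {x \<in> range \<gamma>. a < param x}" for a
  proof -
    have sets: "param -` {a<..} \<in> sets borel"
      using measurable_sets[OF param_measurable, of "{a<..}"] by simp
    have "emeasure ?M {a<..} = emeasure (density hausdorff1 (indicator (range \<gamma>))) (param -` {a<..})"
      by (subst emeasure_distr[OF param]) auto
    also have "\<dots> = emeasure hausdorff1 (range \<gamma> \<inter> param -` {a<..})"
      using sets range_curve_borel
      by (subst emeasure_density) (auto simp: nn_integral_indicator[symmetric] indicator_inter_arith intro!: nn_integral_cong)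
    also have "range \<gamma> \<inter> param -` {a<..} = {x \<in> range \<gamma>. a < param x}" by auto
    finally show ?thesis .
  qed
  have N: "emeasure ?N {a<..} = ennreal (arc_length 1 - arc_length (max a 0))" if "a < 1" for a
  proof -
    let ?a = "max a 0"
    have I: "((\<lambda>t. norm (V t)) has_integral (arc_length 1 - arc_length ?a)) {?a..1}"
      using that arc_length_diff[of ?a 1] by (simp add: has_integral_iff integrable_continuous_real continuous_speed)
    have "emeasure ?N {a<..} = (\<integral>\<^sup>+t. ennreal (norm (V t)) * indicator {0..1} t * indicator {a<..} t \<partial>lborel)"
      using V_meas by (rule emeasure_density) simp
    also have "\<dots> = (\<integral>\<^sup>+t. ennreal (norm (V t)) * indicator {?a..1} t \<partial>lborel)"
      using AE_lborel_singleton[of a] by (intro nn_integral_cong_AE) (auto simp: indicator_def)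
    also have "\<dots> = ennreal (arc_length 1 - arc_length ?a)"
      by (rule nn_integral_has_integral_lebesgue'[OF _ I]) simp
    finally show ?thesis .
  qed
  show "emeasure ?M {a<..} = emeasure ?N {a<..}" for a
  proof -
    consider "a < 0" | "0 \<le> a" "a < 1" | "1 \<le> a" by linarith
    then show ?thesis
    proof cases
      case 1
      then show ?thesis
        by (simp add: M N param_greater emeasure_range_curve arc_length_def)
    next
      case 2
      then have null: "\<gamma> ` {0..a} \<inter> \<gamma> ` {a..1} \<in> null_sets hausdorff1"
        by (intro curve_images_null) auto
      have "range \<gamma> - \<gamma> ` {0..a} = \<gamma> ` {a..1} - \<gamma> ` {0..a} \<inter> \<gamma> ` {a..1}"
      proof -
        have "{0..1} = {0..a} \<union> {a..1}" using 2 by auto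
        then have "range \<gamma> = \<gamma> ` {0..a} \<union> \<gamma> ` {a..1}"
          unfolding range_curve_closed_interval by (metis image_Un)
        then show ?thesis by blast
      qed
      then have "emeasure hausdorff1 (range \<gamma> - \<gamma> ` {0..a}) = emeasure hausdorff1 (\<gamma> ` {a..1})"
        using emeasure_Diff_null_set[OF null, of "\<gamma> ` {a..1}"] curve_image_borel by simp
      then show ?thesis using 2 emeasure_curve[of a] by (simp add: M N param_greater)
    next
      case 3
      have "emeasure ?N {a<..} = (\<integral>\<^sup>+t. ennreal (norm (V t)) * indicator {0..1} t * indicator {a<..} t \<partial>lborel)"
        using V_meas by (rule emeasure_density) simp
      also have "\<dots> = (\<integral>\<^sup>+t. 0 \<partial>(lborel :: real measure))"
        using 3 by (intro nn_integral_cong) (auto simp: indicator_def)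
      finally show ?thesis using 3 by (simp add: M param_greater)
    qed
  qed
  show "emeasure ?M {a<..} < \<infinity>" for a
  proof -
    have "emeasure ?M {a<..} \<le> emeasure hausdorff1 (range \<gamma>)"
      unfolding M using range_curve_borel by (intro emeasure_mono) auto
    then show ?thesis unfolding emeasure_range_curve by (simp add: le_less_trans)
  qed
qed simp_all

text \<open>
  Change of variables. Only the values of \<open>f\<close> on the open period matter because points are null sets; this
  allows for integrands that behave irregularly at \<open>\<gamma> 0\<close>, such as the one of the energy.
\<close>

lemma nn_integral_curve:
  assumes g: "g \<in> borel_measurable borel" and fg: "\<And>t. t \<in> {0<..<1} \<Longrightarrow> f (\<gamma> t) = g t"
  shows "(\<integral>\<^sup>+x\<in>range \<gamma>. f x \<partial>hausdorff1) = (\<integral>\<^sup>+t\<in>{0<..<1}. g t * ennreal (norm (V t)) \<partial>lborel)"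
proof -
  have param: "param \<in> measurable (density hausdorff1 (indicator (range \<gamma>))) borel"
    using param_measurable by (simp cong: measurable_cong_sets)
  have V_meas: "(\<lambda>t. ennreal (norm (V t)) * indicator {0..1} t) \<in> borel_measurable lborel"
    using borel_measurable_continuous_onI[OF continuous_speed] by measurable
  have "AE x in hausdorff1. x \<noteq> \<gamma> 0"
    by (rule AE_I'[of "{\<gamma> 0}"]) (auto simp: null_sets_def)
  then have "(\<integral>\<^sup>+x\<in>range \<gamma>. f x \<partial>hausdorff1) = (\<integral>\<^sup>+x. indicator (range \<gamma>) x * g (param x) \<partial>hausdorff1)"
  proof (intro nn_integral_cong_AE, eventually_elim)
    fix x assume "x \<noteq> \<gamma> 0"
    show "f x * indicator (range \<gamma>) x = indicator (range \<gamma>) x * g (param x)"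
    proof (cases "x \<in> range \<gamma>")
      case True
      note p = curve_param[OF True]
      have "param x \<noteq> 0" using p(2) \<open>x \<noteq> \<gamma> 0\<close> by metis
      then show ?thesis using fg[of "param x"] p True by simp
    qed simp
  qed
  also have "\<dots> = (\<integral>\<^sup>+x. g (param x) \<partial>density hausdorff1 (indicator (range \<gamma>)))"
    using range_curve_borel measurable_compose[OF param_measurable g]
    by (intro nn_integral_density[symmetric]) (auto cong: measurable_cong_sets)
  also have "\<dots> = (\<integral>\<^sup>+t. g t \<partial>distr (density hausdorff1 (indicator (range \<gamma>))) borel param)"
    by (rule nn_integral_distr[OF param, symmetric]) (use g in \<open>simp cong: measurable_cong_sets\<close>)
  also have "\<dots> = (\<integral>\<^sup>+t. ennreal (norm (V t)) * indicator {0..1} t * g t \<partial>lborel)"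
    unfolding distr_param_hausdorff1 using V_meas g by (intro nn_integral_density) simp_all
  also have "\<dots> = (\<integral>\<^sup>+t\<in>{0<..<1}. g t * ennreal (norm (V t)) \<partial>lborel)"
  proof (rule nn_integral_cong_AE)
    show "AE t in lborel. ennreal (norm (V t)) * indicator {0..1} t * g t
        = g t * ennreal (norm (V t)) * indicator {0<..<1} t"
      using AE_lborel_singleton[of 0] AE_lborel_singleton[of 1]
      by eventually_elim (auto simp: indicator_def mult_ac)
  qed
  finally show ?thesis .
qed

end

section \<open>Tangent lines and the tangent-point radius\<close>

text \<open>
  The component of \<open>w\<close> orthogonal to \<open>v\<close>. For \<open>v = 0\<close> division by zero makes it \<open>w\<close>, which is correct as well.
\<close>

definition perp :: "'a::euclidean_space \<Rightarrow> 'a \<Rightarrow> 'a" where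
  "perp v w = w - ((w \<bullet> v) / (v \<bullet> v)) *\<^sub>R v"

lemma perp_scaleR: "perp v (c *\<^sub>R w) = c *\<^sub>R perp v w"
  by (simp add: perp_def scaleR_diff_right)

lemma inner_perp [simp]: "perp v w \<bullet> v = 0"
  by (cases "v = 0") (simp_all add: perp_def inner_diff_left)

lemma norm_perp_squared: "(norm (perp v w))\<^sup>2 = (norm w)\<^sup>2 - (w \<bullet> v)\<^sup>2 / (v \<bullet> v)"
  unfolding power2_norm_eq_inner perp_def
  by (cases "v = 0")
     (simp_all add: inner_diff_left inner_diff_right inner_commute power2_eq_square field_simps)

lemma continuous_perp:
  assumes "continuous_on S f" "continuous_on S g" "\<And>x. x \<in> S \<Longrightarrow> f x \<noteq> 0"
  shows "continuous_on S (\<lambda>x. perp (f x) (g x))"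
  unfolding perp_def using assms by (intro continuous_intros) auto

lemma infdist_span_singleton: "infdist w (span {v}) = norm (perp v w)"
proof (rule antisym)
  have "w - perp v w \<in> span {v}"
    by (auto simp: perp_def span_singleton)
  then show "infdist w (span {v}) \<le> norm (perp v w)"
    using infdist_le[of "w - perp v w" "span {v}" w] by (simp add: dist_norm)
  show "norm (perp v w) \<le> infdist w (span {v})"
    unfolding infdist_def
  proof (simp add: span_singleton, rule cINF_greatest)
    fix a :: 'a assume "a \<in> range (\<lambda>k. k *\<^sub>R v)"
    then obtain k where k: "a = k *\<^sub>R v" by blast
    let ?p = "perp v w"
    have "w - a = ?p + ((w \<bullet> v) / (v \<bullet> v) - k) *\<^sub>R v"
      by (simp add: perp_def k algebra_simps)
    then have "?p \<bullet> ?p = ?p \<bullet> (w - a)"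
      by (simp add: inner_add_right)
    also have "\<dots> \<le> norm ?p * norm (w - a)" by (rule norm_cauchy_schwarz)
    finally have "norm ?p * norm ?p \<le> norm ?p * norm (w - a)"
      by (simp add: norm_eq_sqrt_inner)
    then show "norm ?p \<le> dist w a"
      by (cases "norm ?p = 0") (simp_all add: dist_norm)
  qed simp
qed

lemma perp_eq_0_imp_span: "perp v w = 0 \<Longrightarrow> w \<in> span {v}"
  by (auto simp: perp_def span_singleton)

lemma tendsto_perp: "(f \<longlongrightarrow> l) F \<Longrightarrow> ((\<lambda>t. perp v (f t)) \<longlongrightarrow> perp v l) F"
  unfolding perp_def divide_inverse
  by (intro tendsto_diff tendsto_scaleR tendsto_mult tendsto_inner tendsto_const)

context closed_C1_param begin

text \<open>
  For points \<open>\<gamma> t\<close> with \<open>t\<close> close to \<open>0\<close> this is differentiability. All points of the curve close to \<open>\<gamma> 0\<close>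
  in space are of this form, since the compact rest of the curve has positive distance from \<open>\<gamma> 0\<close>.
\<close>

lemma curve_close_to_tangent:
  assumes "\<eta> > 0"
  shows "\<exists>\<delta>>0. \<forall>z\<in>range \<gamma>. dist z (\<gamma> 0) < \<delta> \<longrightarrow> norm (perp (V 0) (z - \<gamma> 0)) \<le> \<eta> * norm (z - \<gamma> 0)"
proof -
  let ?q = "\<lambda>t. (\<gamma> t - \<gamma> 0) /\<^sub>R (t - 0)"
  have "(?q \<longlongrightarrow> V 0) (at 0)"
    by (rule has_vector_derivative_quotient[OF has_velocity])
  then have "((\<lambda>t. \<eta> * norm (?q t) - norm (perp (V 0) (?q t))) \<longlongrightarrow> \<eta> * norm (V 0) - norm (perp (V 0) (V 0))) (at 0)"
    by (intro tendsto_intros tendsto_perp)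
  then have "\<forall>\<^sub>F t in at 0. 0 < \<eta> * norm (?q t) - norm (perp (V 0) (?q t))"
    by (rule order_tendstoD(1)) (use assms regular[of 0] in \<open>simp add: perp_def\<close>)
  then obtain h where h: "h > 0" "\<And>t. t \<noteq> 0 \<Longrightarrow> \<bar>t\<bar> < h \<Longrightarrow> norm (perp (V 0) (?q t)) < \<eta> * norm (?q t)"
    by (auto simp: eventually_at dist_real_def)
  let ?K = "{-(1/2)..-h} \<union> {h..1/2}"
  have "closed (\<gamma> ` ?K)"
    by (intro compact_imp_closed compact_continuous_image continuous_curve compact_Un) auto
  moreover have "\<gamma> 0 \<notin> \<gamma> ` ?K"
  proof
    assume "\<gamma> 0 \<in> \<gamma> ` ?K"
    then obtain t where t: "t \<in> ?K" "\<gamma> 0 = \<gamma> t" by (elim imageE)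
    have "\<gamma> 0 \<noteq> \<gamma> t" by (rule curve_neq) (use t(1) \<open>h > 0\<close> in auto)
    then show False using t(2) by contradiction
  qed
  ultimately have "\<exists>\<delta>>0. \<forall>x\<in>\<gamma> ` ?K. \<delta> \<le> dist (\<gamma> 0) x"
    by (rule separate_point_closed)
  then obtain \<delta> where \<delta>: "\<delta> > 0" "\<forall>x\<in>\<gamma> ` ?K. \<delta> \<le> dist (\<gamma> 0) x"
    by (elim exE conjE)
  have "norm (perp (V 0) (z - \<gamma> 0)) \<le> \<eta> * norm (z - \<gamma> 0)" if z: "z \<in> range \<gamma>" "dist z (\<gamma> 0) < \<delta>" for z
  proof -
    obtain u where u: "z = \<gamma> u" using z(1) by (elim rangeE)
    define t where "t = u - of_int (round u)"
    have "\<gamma> t = z" using curve_add_int[of t "round u"] by (simp add: u t_def)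
    \<comment> \<open>By periodicity the parameter may be taken in the period centred at \<open>0\<close>.\<close>
    have "\<bar>t\<bar> \<le> 1/2" unfolding t_def using of_int_round_abs_le[of u] by (simp add: abs_minus_commute)
    have "t \<notin> ?K"
    proof
      assume "t \<in> ?K"
      then have "\<delta> \<le> dist (\<gamma> 0) z" using \<delta>(2) \<open>\<gamma> t = z\<close> by blast
      then show False using z(2) by (simp add: dist_commute)
    qed
    then have "\<bar>t\<bar> < h" using \<open>\<bar>t\<bar> \<le> 1/2\<close> by auto
    show ?thesis
    proof (cases "t = 0")
      case True
      then have "z = \<gamma> 0" using \<open>\<gamma> t = z\<close> by simp
      then show ?thesis by (simp add: perp_def)
    next
      case False
      have "norm (perp (V 0) (?q t)) \<le> \<eta> * norm (?q t)"
        using h(2)[OF False \<open>\<bar>t\<bar> < h\<close>] by simp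
      then have "norm (perp (V 0) (z - \<gamma> 0)) / \<bar>t\<bar> \<le> \<eta> * norm (z - \<gamma> 0) / \<bar>t\<bar>"
        unfolding perp_scaleR \<open>\<gamma> t = z\<close> by (simp add: divide_inverse mult_ac)
      then show ?thesis using False by (simp add: divide_le_cancel)
    qed
  qed
  then show ?thesis using \<delta>(1) by blast
qed

text \<open>
  Every velocity of a curve running in \<open>\<Gamma>\<close> is tangent to \<open>\<gamma>\<close> because such a curve stays close to the
  tangent line by the previous lemma. The multiple \<open>a \<gamma>'(0)\<close> is the velocity of \<open>u \<mapsto> \<gamma> (a u)\<close>.
\<close>

lemma tangent_space_0: "tangent_space (range \<gamma>) (\<gamma> 0) = span {V 0}"
proof
  show "span {V 0} \<subseteq> tangent_space (range \<gamma>) (\<gamma> 0)"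
  proof
    fix v assume "v \<in> span {V 0}"
    then obtain a where a: "v = a *\<^sub>R V 0" by (auto simp: span_singleton)
    let ?c = "\<lambda>u. \<gamma> (a * u)"
    have lin: "((\<lambda>u. a * u) has_vector_derivative a) (at u)" for u
      using has_vector_derivative_mult_right[OF has_vector_derivative_id, of a "at u"] by simp
    have D: "(?c has_vector_derivative a *\<^sub>R V (a * u)) (at u)" for u
      using vector_diff_chain_at[OF lin has_velocity, of u] by (simp add: o_def)
    have "continuous_on {-1<..<1} (\<lambda>u. a *\<^sub>R V (a * u))"
      by (intro continuous_intros continuous_on_compose2[OF continuous_velocity[of UNIV]]) auto
    then have "?c C1_differentiable_on {-1<..<1}"
      unfolding C1_differentiable_on_def by (intro exI[of _ "\<lambda>u. a *\<^sub>R V (a * u)"] conjI ballI D)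
    moreover have "(?c has_vector_derivative v) (at 0)" using D[of 0] by (simp add: a)
    ultimately show "v \<in> tangent_space (range \<gamma>) (\<gamma> 0)"
      unfolding tangent_space_def by (intro CollectI exI[of _ ?c] exI[of _ 1]) auto
  qed
  show "tangent_space (range \<gamma>) (\<gamma> 0) \<subseteq> span {V 0}"
  proof
    fix v assume "v \<in> tangent_space (range \<gamma>) (\<gamma> 0)"
    then obtain c \<epsilon> where c: "\<epsilon> > 0" "c ` {-\<epsilon><..<\<epsilon>} \<subseteq> range \<gamma>" "c 0 = \<gamma> 0"
      "(c has_vector_derivative v) (at 0)"
      unfolding tangent_space_def by blast
    let ?q = "\<lambda>u. (c u - c 0) /\<^sub>R (u - 0)"
    have q: "(?q \<longlongrightarrow> v) (at 0)" by (rule has_vector_derivative_quotient[OF c(4)])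
    have "(c \<longlongrightarrow> c 0) (at 0)"
      using has_vector_derivative_continuous[OF c(4)] by (simp add: continuous_at)
    have small: "norm (perp (V 0) v) \<le> \<eta> * norm v" if "\<eta> > 0" for \<eta>
    proof -
      obtain \<delta> where \<delta>: "\<delta> > 0"
        "\<And>z. z \<in> range \<gamma> \<Longrightarrow> dist z (\<gamma> 0) < \<delta> \<Longrightarrow> norm (perp (V 0) (z - \<gamma> 0)) \<le> \<eta> * norm (z - \<gamma> 0)"
        using curve_close_to_tangent[OF \<open>\<eta> > 0\<close>] by blast
      have "\<forall>\<^sub>F u in at 0. dist (c u) (c 0) < \<delta>"
        using \<open>(c \<longlongrightarrow> c 0) (at 0)\<close> \<open>\<delta> > 0\<close> by (rule tendstoD)
      moreover have "\<forall>\<^sub>F u in at (0::real). u \<in> {-\<epsilon><..<\<epsilon>}"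
        using c(1) by (intro eventually_at_in_open') auto
      moreover have "\<forall>\<^sub>F u in at (0::real). u \<noteq> 0" by (simp add: eventually_at_filter)
      ultimately have "\<forall>\<^sub>F u in at 0. norm (perp (V 0) (?q u)) \<le> \<eta> * norm (?q u)"
      proof eventually_elim
        case (elim u)
        then have "norm (perp (V 0) (c u - c 0)) \<le> \<eta> * norm (c u - c 0)"
          using \<delta>(2)[of "c u"] c(2) unfolding c(3) by blast
        then have "norm (perp (V 0) (c u - c 0)) * inverse \<bar>u\<bar> \<le> \<eta> * norm (c u - c 0) * inverse \<bar>u\<bar>"
          by (rule mult_right_mono) simp
        then show ?case unfolding perp_scaleR by (simp add: mult_ac)
      qed
      then show ?thesis
        by (intro tendsto_le[OF _ _ _ , of "at 0" "\<lambda>u. \<eta> * norm (?q u)" _ "\<lambda>u. norm (perp (V 0) (?q u))"]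
            tendsto_intros tendsto_perp q) simp_all
    qed
    have "perp (V 0) v = 0"
    proof (rule ccontr)
      assume ne: "perp (V 0) v \<noteq> 0"
      then have "v \<noteq> 0" by (auto simp: perp_def)
      then show False using small[of "norm (perp (V 0) v) / (2 * norm v)"] ne by simp
    qed
    then show "v \<in> span {V 0}" by (rule perp_eq_0_imp_span)
  qed
qed

lemma tangent_space_curve: "tangent_space (range \<gamma>) (\<gamma> t) = span {V t}"
proof -
  interpret sh: closed_C1_param "\<lambda>u. \<gamma> (t + u)" by (rule shift)
  show ?thesis using sh.tangent_space_0 unfolding range_shift velocity_shift by simp
qed

text \<open>
  The reciprocal of \<open>R\<^sub>t\<^sub>p(\<gamma> t, \<gamma> s)\<close> as a real number. It is the tangent at the second argument \<open>t\<close> that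
  enters.
\<close>

definition tp_curvature :: "real \<Rightarrow> real \<Rightarrow> real" where
  "tp_curvature s t = 2 * norm (perp (V t) (\<gamma> t - \<gamma> s)) / (norm (\<gamma> t - \<gamma> s))\<^sup>2"

lemma tp_curvature_nonneg: "0 \<le> tp_curvature s t"
  by (simp add: tp_curvature_def)

lemma tangent_point_radius_curve:
  assumes "\<gamma> t \<noteq> \<gamma> s" "p > 0"
  shows "1 / ennpowr (tangent_point_radius (range \<gamma>) (\<gamma> t) (\<gamma> s)) p = ennreal (tp_curvature s t powr p)"
proof -
  define w where "w = norm (\<gamma> t - \<gamma> s)"
  define d where "d = norm (perp (V t) (\<gamma> t - \<gamma> s))"
  have R: "tangent_point_radius (range \<gamma>) (\<gamma> t) (\<gamma> s) = ennreal (w\<^sup>2) / ennreal (2 * d)"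
    by (simp add: tangent_point_radius_def tangent_space_curve infdist_span_singleton w_def d_def)
  have k: "tp_curvature s t = 2 * d / w\<^sup>2" by (simp add: tp_curvature_def w_def d_def)
  have w: "w > 0" using assms by (simp add: w_def)
  show ?thesis
  proof (cases "d = 0")
    case True
    then show ?thesis using w \<open>p > 0\<close>
      by (simp add: R k ennpowr_def ennreal_divide_zero)
  next
    case False
    then have d: "d > 0" by (simp add: d_def)
    have "tangent_point_radius (range \<gamma>) (\<gamma> t) (\<gamma> s) = ennreal (w\<^sup>2 / (2 * d))"
      unfolding R using w d by (simp add: divide_ennreal)
    then have "ennpowr (tangent_point_radius (range \<gamma>) (\<gamma> t) (\<gamma> s)) p = ennreal ((w\<^sup>2 / (2 * d)) powr p)"
      using w d \<open>p > 0\<close> by (simp add: ennpowr_def)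
    then have "1 / ennpowr (tangent_point_radius (range \<gamma>) (\<gamma> t) (\<gamma> s)) p = ennreal (1 / (w\<^sup>2 / (2 * d)) powr p)"
      using w d by (simp add: divide_ennreal[symmetric])
    also have "1 / (w\<^sup>2 / (2 * d)) powr p = tp_curvature s t powr p"
      using w d unfolding k by (simp add: powr_divide powr_mult)
    finally show ?thesis .
  qed
qed

lemma borel_measurable_curve [measurable]: "\<gamma> \<in> borel_measurable borel" "V \<in> borel_measurable borel"
  by (auto intro: borel_measurable_continuous_onI continuous_curve continuous_velocity)

lemma borel_measurable_tp_curvature [measurable]:
  assumes [measurable]: "f \<in> borel_measurable M" "g \<in> borel_measurable M"
  shows "(\<lambda>x. tp_curvature (f x) (g x)) \<in> borel_measurable M"
proof -
  have [measurable]: "(\<lambda>x. V (g x)) \<in> borel_measurable M"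
    "(\<lambda>x. \<gamma> (g x)) \<in> borel_measurable M" "(\<lambda>x. \<gamma> (f x)) \<in> borel_measurable M"
    by (auto intro: measurable_compose[OF _ borel_measurable_curve(1)]
        measurable_compose[OF _ borel_measurable_curve(2)] assms)
  show ?thesis unfolding tp_curvature_def perp_def by measurable
qed

lemma tp_curvature_shift:
  "closed_C1_param.tp_curvature (\<lambda>t. \<gamma> (s + t)) u t = tp_curvature (s + u) (s + t)"
proof -
  interpret sh: closed_C1_param "\<lambda>t. \<gamma> (s + t)" by (rule shift)
  show ?thesis by (simp add: sh.tp_curvature_def tp_curvature_def velocity_shift)
qed

definition tp_potential :: "real \<Rightarrow> real \<Rightarrow> ennreal" where
  "tp_potential p s = (\<integral>\<^sup>+x\<in>range \<gamma>. 1 / ennpowr (tangent_point_radius (range \<gamma>) x (\<gamma> s)) p \<partial>hausdorff1)"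

lemma tp_potential_0:
  assumes "p > 0"
  shows "tp_potential p 0 =
    (\<integral>\<^sup>+t\<in>{0<..<1}. ennreal (tp_curvature 0 t powr p) * ennreal (norm (V t)) \<partial>lborel)"
  unfolding tp_potential_def
proof (rule nn_integral_curve)
  show "(\<lambda>t. ennreal (tp_curvature 0 t powr p)) \<in> borel_measurable borel"
    by measurable
  show "1 / ennpowr (tangent_point_radius (range \<gamma>) (\<gamma> t) (\<gamma> 0)) p = ennreal (tp_curvature 0 t powr p)"
    if "t \<in> {0<..<1}" for t
    using that curve_neq[of t 0] assms by (intro tangent_point_radius_curve) auto
qed

lemma tp_potential_shift: "closed_C1_param.tp_potential (\<lambda>t. \<gamma> (s + t)) p u = tp_potential p (s + u)"
proof -
  interpret sh: closed_C1_param "\<lambda>t. \<gamma> (s + t)" by (rule shift)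
  show ?thesis by (simp add: sh.tp_potential_def tp_potential_def range_shift)
qed

lemma tp_potential_eq:
  assumes "p > 0"
  shows "tp_potential p s =
    (\<integral>\<^sup>+t\<in>{0<..<1}. ennreal (tp_curvature s (s + t) powr p) * ennreal (norm (V (s + t))) \<partial>lborel)"
proof -
  interpret sh: closed_C1_param "\<lambda>t. \<gamma> (s + t)" by (rule shift)
  show ?thesis
    using sh.tp_potential_0[OF assms] by (simp add: tp_curvature_shift tp_potential_shift velocity_shift)
qed

text \<open>
  Measurability is visible after the change of variables, where the integrand is an explicit Borel
  function of both parameters.
\<close>

lemma borel_measurable_tp_potential [measurable]:
  assumes "p > 0" shows "tp_potential p \<in> borel_measurable borel"
  unfolding tp_potential_eq[OF assms, abs_def]
proof (rule lborel.borel_measurable_nn_integral)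
  have [measurable]: "(\<lambda>x. V (fst x + snd x)) \<in> borel_measurable (borel \<Otimes>\<^sub>M lborel)"
    by (intro measurable_compose[OF _ borel_measurable_curve(2)]) measurable
  show "(\<lambda>(s, t). ennreal (tp_curvature s (s + t) powr p) * ennreal (norm (V (s + t))) * indicator {0<..<1} t)
      \<in> borel_measurable (borel \<Otimes>\<^sub>M lborel)"
    unfolding split_beta by measurable
qed

lemma tangent_point_energy_curve:
  assumes "p > 0"
  shows "tangent_point_energy p (range \<gamma>) =
    (\<integral>\<^sup>+s\<in>{0<..<1}. tp_potential p s * ennreal (norm (V s)) \<partial>lborel)"
  unfolding tangent_point_energy_def
  by (rule nn_integral_curve[OF borel_measurable_tp_potential[OF assms]]) (simp add: tp_potential_def)

end

section \<open>The direction of the chord as a path on the sphere\<close>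

text \<open>
  Both sides are the area of the parallelogram spanned by \<open>v\<close> and \<open>w\<close>.
\<close>

lemma norm_perp_swap:
  assumes "v \<noteq> 0" "w \<noteq> 0"
  shows "norm (perp w v) * norm w = norm (perp v w) * norm v"
proof -
  have "(norm (perp w v) * norm w)\<^sup>2 = (norm (perp v w) * norm v)\<^sup>2"
    using assms unfolding power_mult_distrib norm_perp_squared
    by (simp add: power2_norm_eq_inner inner_commute field_simps)
  then show ?thesis by (simp add: power2_eq_iff_nonneg)
qed

lemma has_vector_derivative_unit:
  fixes f :: "real \<Rightarrow> 'a::euclidean_space"
  assumes f: "(f has_vector_derivative v) (at t)" and nz: "f t \<noteq> 0"
  shows "((\<lambda>t. f t /\<^sub>R norm (f t)) has_vector_derivative perp (f t) v /\<^sub>R norm (f t)) (at t)"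
proof -
  have N: "((\<lambda>t. norm (f t)) has_vector_derivative v \<bullet> sgn (f t)) (at t)"
    using has_derivative_compose[OF f[unfolded has_vector_derivative_def] has_derivative_norm[OF nz]]
    by (simp add: has_vector_derivative_def mult.commute)
  have "((\<lambda>t. inverse (norm (f t))) has_real_derivative - (inverse (norm (f t)) * (v \<bullet> sgn (f t)) * inverse (norm (f t)))) (at t)"
    using N nz unfolding has_real_derivative_iff_has_vector_derivative[symmetric]
    by (intro DERIV_inverse') auto
  from has_vector_derivative_scaleR[OF this f] show ?thesis
    by (rule has_vector_derivative_eq_rhs)
       (use nz in \<open>simp add: perp_def sgn_div_norm scaleR_diff_right power2_norm_eq_inner[symmetric] power2_eq_square divide_inverse algebra_simps\<close>)
qed

text \<open>
  The right-hand factor is the length of the projection of \<open>e\<close> to the tangent space of the sphere at \<open>u\<close>, in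
  which \<open>v\<close> lies. For a path \<open>u\<close> on the sphere with velocity \<open>v\<close> this says that the angle between \<open>u\<close> and
  \<open>e\<close> changes at most with speed \<open>\<bar>v\<bar>\<close>.
\<close>

lemma abs_inner_tangent_le:
  fixes u e v :: "'a::real_inner"
  assumes "norm u = 1" "norm e = 1" "v \<bullet> u = 0"
  shows "\<bar>v \<bullet> e\<bar> \<le> norm v * sqrt (1 - (u \<bullet> e)\<^sup>2)"
proof -
  have "(norm (e - (u \<bullet> e) *\<^sub>R u))\<^sup>2 = 1 - (u \<bullet> e)\<^sup>2"
    using assms(1,2) unfolding power2_norm_eq_inner
    by (simp add: inner_diff_left inner_diff_right inner_commute power2_eq_square norm_eq_1)
  then have n: "norm (e - (u \<bullet> e) *\<^sub>R u) = sqrt (1 - (u \<bullet> e)\<^sup>2)"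
    by (metis norm_ge_zero real_sqrt_abs abs_of_nonneg)
  have "v \<bullet> e = v \<bullet> (e - (u \<bullet> e) *\<^sub>R u)" using assms(3) by (simp add: inner_diff_right)
  then show ?thesis using Cauchy_Schwarz_ineq2[of v "e - (u \<bullet> e) *\<^sub>R u"] by (simp add: n)
qed

lemma tendsto_arcsin_sequence:
  assumes "x \<longlonglongrightarrow> l" "\<And>n. x n \<in> {-1..1}" "l \<in> {-1..1}"
  shows "(\<lambda>n. arcsin (x n)) \<longlonglongrightarrow> arcsin l"
  by (rule continuous_on_tendsto_compose[OF continuous_on_arcsin' assms(1) assms(3)]) (use assms(2) in auto)

context closed_C1_param begin

abbreviation chord :: "real \<Rightarrow> 'a" where "chord t \<equiv> \<gamma> t - \<gamma> 0"

definition dir :: "real \<Rightarrow> 'a" where "dir t = chord t /\<^sub>R norm (chord t)"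

definition init_dir :: 'a where "init_dir = V 0 /\<^sub>R norm (V 0)"

text \<open>
  The speed of the path \<^term>\<open>dir\<close> on the sphere, see lemma \<open>dir_has_derivative\<close>.
\<close>

definition dir_speed :: "real \<Rightarrow> real" where "dir_speed t = norm (perp (chord t) (V t)) / norm (chord t)"

lemma borel_measurable_dir_speed [measurable]: "dir_speed \<in> borel_measurable borel"
  unfolding dir_speed_def[abs_def] perp_def by measurable

lemma norm_init_dir: "norm init_dir = 1" using regular[of 0] by (simp add: init_dir_def)

lemma chord_nz: "t \<in> {0<..<1} \<Longrightarrow> chord t \<noteq> 0"
  using curve_neq[of t 0] by simp

lemma norm_dir: "t \<in> {0<..<1} \<Longrightarrow> norm (dir t) = 1"
  using chord_nz[of t] by (simp add: dir_def)

lemma velocity_1: "V 1 = V 0"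
  using velocity_shift[of 1 0] periodic by (simp add: add.commute)

lemma curve_1: "\<gamma> 1 = \<gamma> 0" using periodic[of 0] by simp

text \<open>
  The reason why the tangent-point radius is related to the path of directions: the distance of the
  chord from the tangent and the normal component of the velocity relative to the chord measure the
  same angle.
\<close>

lemma dir_speed_eq: "t \<in> {0<..<1} \<Longrightarrow> tp_curvature 0 t * norm (V t) = 2 * dir_speed t"
  using norm_perp_swap[OF regular[of t] chord_nz[of t]] chord_nz[of t]
  by (simp add: tp_curvature_def dir_speed_def power2_eq_square field_simps)

lemma dir_has_derivative:
  assumes "t \<in> {0<..<1}"
  shows "(dir has_vector_derivative perp (chord t) (V t) /\<^sub>R norm (chord t)) (at t)"
  unfolding dir_def[abs_def]
  using chord_nz[OF assms] has_velocity[of t UNIV]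
  by (intro has_vector_derivative_unit[where f = "\<lambda>t. chord t"]) (auto intro!: derivative_eq_intros)

lemma dir_inner_has_derivative:
  assumes "t \<in> {0<..<1}"
  shows "((\<lambda>t. dir t \<bullet> init_dir) has_real_derivative (perp (chord t) (V t) /\<^sub>R norm (chord t)) \<bullet> init_dir) (at t)"
  unfolding has_real_derivative_iff_has_vector_derivative
  by (rule bounded_linear.has_vector_derivative[OF bounded_linear_inner_left dir_has_derivative[OF assms]])

lemma dir_inner_derivative_le:
  assumes "t \<in> {0<..<1}"
  shows "\<bar>(perp (chord t) (V t) /\<^sub>R norm (chord t)) \<bullet> init_dir\<bar> \<le> dir_speed t * sqrt (1 - (dir t \<bullet> init_dir)\<^sup>2)"
proof -
  have "\<bar>(perp (chord t) (V t) /\<^sub>R norm (chord t)) \<bullet> init_dir\<bar>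
      \<le> norm (perp (chord t) (V t) /\<^sub>R norm (chord t)) * sqrt (1 - (dir t \<bullet> init_dir)\<^sup>2)"
    by (intro abs_inner_tangent_le norm_dir assms norm_init_dir) (simp add: dir_def)
  also have "norm (perp (chord t) (V t) /\<^sub>R norm (chord t)) = dir_speed t"
    by (simp add: dir_speed_def divide_inverse mult.commute)
  finally show ?thesis .
qed

lemma continuous_dir_speed: "S \<subseteq> {0<..<1} \<Longrightarrow> continuous_on S dir_speed"
  unfolding dir_speed_def[abs_def] using chord_nz
  by (intro continuous_intros continuous_perp continuous_curve continuous_velocity) auto

lemma dir_inner_bounds: "t \<in> {0<..<1} \<Longrightarrow> dir t \<bullet> init_dir \<in> {-1..1}"
  using Cauchy_Schwarz_ineq2[of "dir t" init_dir] norm_dir[of t] norm_init_dir by (simp add: abs_le_iff)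

lemma dir_tendsto_right: "(dir \<longlongrightarrow> init_dir) (at_right 0)"
proof -
  let ?q = "\<lambda>t. (\<gamma> t - \<gamma> 0) /\<^sub>R (t - 0)"
  have "(?q \<longlongrightarrow> V 0) (at_right 0)"
    by (rule has_vector_derivative_quotient[OF has_velocity])
  then have "((\<lambda>t. ?q t /\<^sub>R norm (?q t)) \<longlongrightarrow> init_dir) (at_right 0)"
    unfolding init_dir_def using regular[of 0] by (intro tendsto_intros) auto
  moreover have "\<forall>\<^sub>F t in at_right 0. ?q t /\<^sub>R norm (?q t) = dir t"
    by (auto simp: eventually_at_filter dir_def)
  ultimately show ?thesis by (rule Lim_transform_eventually)
qed

text \<open>
  Just before the curve closes up, the point \<open>\<gamma> t\<close> lies behind \<open>\<gamma> 0 = \<gamma> 1\<close>.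
\<close>

lemma dir_tendsto_left: "(dir \<longlongrightarrow> - init_dir) (at_left 1)"
proof -
  let ?q = "\<lambda>t. (\<gamma> t - \<gamma> 1) /\<^sub>R (t - 1)"
  have "(?q \<longlongrightarrow> V 1) (at_left 1)"
    by (rule has_vector_derivative_quotient[OF has_velocity])
  then have "((\<lambda>t. - (?q t /\<^sub>R norm (?q t))) \<longlongrightarrow> - init_dir) (at_left 1)"
    unfolding init_dir_def velocity_1 using regular[of 0] by (intro tendsto_intros) auto
  moreover have "\<forall>\<^sub>F t in at_left 1. - (?q t /\<^sub>R norm (?q t)) = dir t"
    by (auto simp: eventually_at_filter dir_def curve_1 inverse_eq_divide divide_simps scaleR_minus_left[symmetric] simp del: scaleR_minus_left)
  ultimately show ?thesis by (rule Lim_transform_eventually)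
qed

text \<open>
  The angle between the direction and the initial direction is the complement of an arcsine, whose
  derivative is bounded by the speed. The arcsine is not differentiable at \<open>\<plusminus>1\<close>, where the path may
  pass through the poles; shrinking its argument by a factor \<open>c < 1\<close> avoids this, keeps the bound on the
  derivative, and does not affect the result in the limit \<open>c \<rightarrow> 1\<close>.
\<close>

lemma dir_speed_integral_ge:
  assumes "0 < a" "a \<le> b" "b < 1"
  shows "arcsin (dir a \<bullet> init_dir) - arcsin (dir b \<bullet> init_dir) \<le> integral {a..b} dir_speed"
proof -
  define g where "g t = dir t \<bullet> init_dir" for t
  define g' where "g' t = (perp (chord t) (V t) /\<^sub>R norm (chord t)) \<bullet> init_dir" for t
  have sub: "t \<in> {0<..<1}" if "t \<in> {a..b}" for t using that assms by auto
  have le: "arcsin (c * g a) - arcsin (c * g b) \<le> integral {a..b} dir_speed" if c: "0 < c" "c < 1" for c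
  proof -
    have g1: "\<bar>c * g t\<bar> < 1" if "t \<in> {a..b}" for t
    proof -
      have "\<bar>g t\<bar> \<le> 1" using dir_inner_bounds[OF sub[OF that]] by (simp add: g_def abs_le_iff)
      then have "c * \<bar>g t\<bar> \<le> c * 1" using c by (intro mult_left_mono) auto
      then have "c * \<bar>g t\<bar> < 1" using c by linarith
      then show ?thesis using c by (simp add: abs_mult)
    qed
    have D: "((\<lambda>t. - arcsin (c * g t)) has_vector_derivative - (c * g' t / sqrt (1 - (c * g t)\<^sup>2))) (at t within {a..b})"
      if "t \<in> {a..b}" for t
    proof -
      have "(g has_real_derivative g' t) (at t)"
        using dir_inner_has_derivative[OF sub[OF that]] by (simp add: g_def[abs_def] g'_def)
      then have "((\<lambda>t. - arcsin (c * g t)) has_real_derivative - (c * g' t / sqrt (1 - (c * g t)\<^sup>2))) (at t)"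
        using g1[OF that] by (auto intro!: derivative_eq_intros simp: divide_inverse abs_less_iff)
      then show ?thesis
        using has_vector_derivative_at_within has_real_derivative_iff_has_vector_derivative by blast
    qed
    have "((\<lambda>t. - (c * g' t / sqrt (1 - (c * g t)\<^sup>2))) has_integral (- arcsin (c * g b) - - arcsin (c * g a))) {a..b}"
      using assms(2) D by (rule fundamental_theorem_of_calculus)
    moreover have "(dir_speed has_integral integral {a..b} dir_speed) {a..b}"
      using sub by (intro integrable_integral integrable_continuous_real continuous_dir_speed) auto
    moreover have "- (c * g' t / sqrt (1 - (c * g t)\<^sup>2)) \<le> dir_speed t" if "t \<in> {a..b}" for t
    proof -
      have g2: "(c * g t)\<^sup>2 < 1" using g1[OF that] by (simp add: abs_square_less_1)
      have "c\<^sup>2 \<le> 1" using c by (simp add: power_le_one)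
      then have "c\<^sup>2 * (1 - (g t)\<^sup>2) \<le> 1 - (c * g t)\<^sup>2"
        by (simp add: power_mult_distrib right_diff_distrib)
      moreover have "c * sqrt (1 - (g t)\<^sup>2) = sqrt (c\<^sup>2 * (1 - (g t)\<^sup>2))"
        using c by (simp add: real_sqrt_mult)
      ultimately have "c * sqrt (1 - (g t)\<^sup>2) \<le> sqrt (1 - (c * g t)\<^sup>2)"
        by (simp only: real_sqrt_le_mono)
      have "- (c * g' t) \<le> c * \<bar>g' t\<bar>" using c by (simp add: abs_if)
      also have "\<dots> \<le> c * (dir_speed t * sqrt (1 - (g t)\<^sup>2))"
        using dir_inner_derivative_le[OF sub[OF that]] c by (simp add: g_def g'_def)
      also have "\<dots> = dir_speed t * (c * sqrt (1 - (g t)\<^sup>2))" by simp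
      also have "\<dots> \<le> dir_speed t * sqrt (1 - (c * g t)\<^sup>2)"
        by (rule mult_left_mono) (fact, simp add: dir_speed_def)
      finally show ?thesis using g2 by (simp add: field_simps)
    qed
    ultimately have "- arcsin (c * g b) - - arcsin (c * g a) \<le> integral {a..b} dir_speed"
      by (rule has_integral_le)
    then show ?thesis by simp
  qed
  define c where "c n = 1 - 1 / real (n + 2)" for n
  have c: "0 < c n" "c n < 1" for n by (auto simp: c_def field_simps)
  have "(\<lambda>n. 1 / real (n + 2)) \<longlonglongrightarrow> 0"
    using LIMSEQ_ignore_initial_segment[OF lim_1_over_n, of 2] by simp
  then have "(\<lambda>n. 1 - 1 / real (n + 2)) \<longlonglongrightarrow> 1 - 0"
    by (intro tendsto_diff tendsto_const)
  then have c1: "c \<longlonglongrightarrow> 1" by (simp add: c_def[abs_def])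
  have lim: "(\<lambda>n. arcsin (c n * g t)) \<longlonglongrightarrow> arcsin (g t)" if "t \<in> {a..b}" for t
  proof (rule tendsto_arcsin_sequence)
    show "(\<lambda>n. c n * g t) \<longlonglongrightarrow> g t" using tendsto_mult_right[OF c1, of "g t"] by simp
    show "g t \<in> {-1..1}" using dir_inner_bounds[OF sub[OF that]] by (simp add: g_def)
    then have "\<bar>g t\<bar> \<le> 1" by (simp add: abs_le_iff)
    then have "\<bar>c n * g t\<bar> \<le> 1" for n
      using mult_mono[of "c n" 1 "\<bar>g t\<bar>" 1] c[of n] by (simp add: abs_mult)
    then show "c n * g t \<in> {-1..1}" for n by (simp add: abs_le_iff)
  qed
  have "(\<lambda>n. arcsin (c n * g a) - arcsin (c n * g b)) \<longlonglongrightarrow> arcsin (g a) - arcsin (g b)"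
    using assms(2) by (intro tendsto_diff lim) auto
  then show ?thesis
    using le[OF c] unfolding g_def[symmetric] by (intro LIMSEQ_le_const2) auto
qed

lemma arcsin_dir_tendsto:
  "((\<lambda>t. arcsin (dir t \<bullet> init_dir)) \<longlongrightarrow> pi / 2) (at_right 0)"
  "((\<lambda>t. arcsin (dir t \<bullet> init_dir)) \<longlongrightarrow> - pi / 2) (at_left 1)"
proof -
  have e: "init_dir \<bullet> init_dir = 1" using norm_init_dir by (simp add: norm_eq_1)
  have ev0: "\<forall>\<^sub>F t in at_right 0. t \<in> {0<..<1::real}" using eventually_at_right_real[of 0 1] by simp
  have ev1: "\<forall>\<^sub>F t in at_left 1. t \<in> {0<..<1::real}" using eventually_at_left_real[of 0 1] by simp
  have "((\<lambda>t. dir t \<bullet> init_dir) \<longlongrightarrow> 1) (at_right 0)"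
    using tendsto_inner[OF dir_tendsto_right tendsto_const[of init_dir]] by (simp add: e)
  then have "((\<lambda>t. arcsin (dir t \<bullet> init_dir)) \<longlongrightarrow> arcsin 1) (at_right 0)"
    by (rule continuous_on_tendsto_compose[OF continuous_on_arcsin'])
       (use eventually_mono[OF ev0 dir_inner_bounds] in simp_all)
  then show "((\<lambda>t. arcsin (dir t \<bullet> init_dir)) \<longlongrightarrow> pi / 2) (at_right 0)" by simp
  have "((\<lambda>t. dir t \<bullet> init_dir) \<longlongrightarrow> -1) (at_left 1)"
    using tendsto_inner[OF dir_tendsto_left tendsto_const[of init_dir]] by (simp add: e)
  then have "((\<lambda>t. arcsin (dir t \<bullet> init_dir)) \<longlongrightarrow> arcsin (-1)) (at_left 1)"
    by (rule continuous_on_tendsto_compose[OF continuous_on_arcsin'])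
       (use eventually_mono[OF ev1 dir_inner_bounds] in simp_all)
  then show "((\<lambda>t. arcsin (dir t \<bullet> init_dir)) \<longlongrightarrow> - pi / 2) (at_left 1)" by simp
qed

text \<open>
  The directions start at \<^term>\<open>init_dir\<close> and end at \<^term>\<open>- init_dir\<close>, so their path on the sphere
  connects antipodal points.
\<close>

lemma dir_length_ge: "ennreal pi \<le> (\<integral>\<^sup>+t\<in>{0<..<1}. ennreal (dir_speed t) \<partial>lborel)"
proof -
  let ?I = "\<integral>\<^sup>+t\<in>{0<..<1}. ennreal (dir_speed t) \<partial>lborel"
  have le: "ennreal (arcsin (dir a \<bullet> init_dir) - arcsin (dir b \<bullet> init_dir)) \<le> ?I" if "0 < a" "a \<le> b" "b < 1" for a b
  proof -
    have "(dir_speed has_integral integral {a..b} dir_speed) {a..b}"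
      using that by (intro integrable_integral integrable_continuous_real continuous_dir_speed) auto
    then have "(\<integral>\<^sup>+t\<in>{a..b}. ennreal (dir_speed t) \<partial>lborel) = ennreal (integral {a..b} dir_speed)"
      by (intro nn_integral_has_integral_lebesgue') (simp add: dir_speed_def)
    moreover have "(\<integral>\<^sup>+t\<in>{a..b}. ennreal (dir_speed t) \<partial>lborel) \<le> ?I"
      using that by (intro nn_integral_mono) (auto simp: indicator_def)
    ultimately show ?thesis
      using ennreal_leI[OF dir_speed_integral_ge[OF that]] by simp
  qed
  have r0: "filterlim (\<lambda>n. 1 / real (n + 2)) (at_right 0) sequentially"
    unfolding filterlim_at
    using LIMSEQ_ignore_initial_segment[OF lim_1_over_n, of 2] by (auto intro!: always_eventually)
  have r1: "filterlim (\<lambda>n. 1 - 1 / real (n + 2)) (at_left 1) sequentially"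
    unfolding filterlim_at
    using tendsto_diff[OF tendsto_const[of 1] LIMSEQ_ignore_initial_segment[OF lim_1_over_n, of 2]]
    by (auto intro!: always_eventually)
  have "(\<lambda>n. arcsin (dir (1 / real (n + 2)) \<bullet> init_dir) - arcsin (dir (1 - 1 / real (n + 2)) \<bullet> init_dir))
      \<longlonglongrightarrow> pi / 2 - (- pi / 2)"
    by (intro tendsto_diff filterlim_compose[OF arcsin_dir_tendsto(1) r0] filterlim_compose[OF arcsin_dir_tendsto(2) r1])
  then have "(\<lambda>n. ennreal (arcsin (dir (1 / real (n + 2)) \<bullet> init_dir) - arcsin (dir (1 - 1 / real (n + 2)) \<bullet> init_dir)))
      \<longlonglongrightarrow> ennreal (pi / 2 - (- pi / 2))"
    by (rule tendsto_ennrealI)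
  then have "ennreal (pi / 2 - (- pi / 2)) \<le> ?I"
    by (rule LIMSEQ_le_const2) (use le in \<open>auto simp: field_simps\<close>)
  then show ?thesis by simp
qed

lemma curvature_integral_ge:
  "ennreal (2 * pi) \<le> (\<integral>\<^sup>+t\<in>{0<..<1}. ennreal (tp_curvature 0 t) * ennreal (norm (V t)) \<partial>lborel)"
proof -
  have "ennreal (2 * pi) = 2 * ennreal pi" by (simp add: ennreal_mult)
  also have "\<dots> \<le> 2 * (\<integral>\<^sup>+t\<in>{0<..<1}. ennreal (dir_speed t) \<partial>lborel)"
    by (intro mult_left_mono dir_length_ge) simp
  also have "\<dots> = (\<integral>\<^sup>+t. 2 * (ennreal (dir_speed t) * indicator {0<..<1} t) \<partial>lborel)"
    by (rule nn_integral_cmult[symmetric]) measurable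
  also have "\<dots> = (\<integral>\<^sup>+t\<in>{0<..<1}. ennreal (tp_curvature 0 t) * ennreal (norm (V t)) \<partial>lborel)"
  proof (rule nn_integral_cong)
    fix t
    show "2 * (ennreal (dir_speed t) * indicator {0<..<1} t)
        = ennreal (tp_curvature 0 t) * ennreal (norm (V t)) * indicator {0<..<1} t"
    proof (cases "t \<in> {0<..<1}")
      case True
      have "2 * ennreal (dir_speed t) = ennreal (2 * dir_speed t)"
        by (subst ennreal_mult) (simp_all add: dir_speed_def)
      also have "\<dots> = ennreal (tp_curvature 0 t) * ennreal (norm (V t))"
        by (simp add: ennreal_mult tp_curvature_nonneg flip: dir_speed_eq[OF True])
      finally show ?thesis using True by simp
    qed simp
  qed
  finally show ?thesis .
qed

end

section \<open>The lower bound for the energy\<close>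

lemma bernoulli_powr_strict:
  fixes x p :: real
  assumes "0 \<le> x" "x \<noteq> 1" "p > 1"
  shows "1 + p * (x - 1) < x powr p"
proof (cases "x = 0")
  case False
  then have "x > 0" using assms by simp
  have D: "((\<lambda>x. x powr p) has_real_derivative p * z powr (p - 1)) (at z)" if "z > 0" for z
    using that by (auto intro!: derivative_eq_intros)
  show ?thesis
  proof (cases "x > 1")
    case True
    obtain z where z: "1 < z" "z < x" "x powr p - 1 powr p = (x - 1) * (p * z powr (p - 1))"
      using MVT2[OF True, of "\<lambda>x. x powr p" "\<lambda>z. p * z powr (p - 1)"] D by auto
    have "1 < z powr (p - 1)" using powr_less_mono2[of "p - 1" 1 z] z assms by simp
    then have "(x - 1) * (p * 1) < (x - 1) * (p * z powr (p - 1))"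
      using True assms by (intro mult_strict_left_mono) auto
    then show ?thesis using z(3) by (simp add: mult.commute)
  next
    case less: False
    then have "x < 1" using assms by simp
    obtain z where z: "x < z" "z < 1" "1 powr p - x powr p = (1 - x) * (p * z powr (p - 1))"
      using MVT2[OF \<open>x < 1\<close>, of "\<lambda>x. x powr p" "\<lambda>z. p * z powr (p - 1)"] D \<open>x > 0\<close> by auto
    have "z powr (p - 1) < 1" using powr_less_mono2[of "p - 1" z 1] z \<open>x > 0\<close> assms by simp
    then have "(1 - x) * (p * z powr (p - 1)) < (1 - x) * (p * 1)"
      using \<open>x < 1\<close> assms by (intro mult_strict_left_mono) auto
    then show ?thesis using z(3) by (simp add: algebra_simps)
  qed
qed (use assms in simp)

text \<open>
  A strictly convex function lies above its tangent and touches it only once. Used in place of the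
  inequalities of Hoelder or Jensen, because it works pointwise and makes the case of equality explicit.
\<close>

lemma powr_above_tangent:
  fixes a c p :: real
  assumes "0 \<le> a" "0 < c" "1 < p"
  shows "p * c powr (p - 1) * a \<le> a powr p + (p - 1) * c powr p"
    and "p * c powr (p - 1) * a = a powr p + (p - 1) * c powr p \<Longrightarrow> a = c"
proof -
  have cp: "c powr p = c powr (p - 1) * c" using assms by (simp add: powr_diff)
  have *: "p * c powr (p - 1) * a < a powr p + (p - 1) * c powr p" if "a \<noteq> c"
  proof -
    have "1 + p * (a / c - 1) < (a / c) powr p"
      by (rule bernoulli_powr_strict) (use assms that in auto)
    also have "\<dots> = a powr p / c powr p" using assms by (simp add: powr_divide)
    finally have "(1 + p * (a / c - 1)) * c powr p < a powr p"
      using assms by (simp add: pos_less_divide_eq)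
    moreover have "(1 + p * (a / c - 1)) * c powr p = p * c powr (p - 1) * a - (p - 1) * c powr p"
      unfolding cp using assms by (simp add: field_simps)
    ultimately show ?thesis by linarith
  qed
  have "p * c powr (p - 1) * c = c powr p + (p - 1) * c powr p"
    unfolding cp by (simp add: algebra_simps)
  then show "p * c powr (p - 1) * a \<le> a powr p + (p - 1) * c powr p"
    using * by (cases "a = c") auto
  show "p * c powr (p - 1) * a = a powr p + (p - 1) * c powr p \<Longrightarrow> a = c"
    using * by force
qed

text \<open>
  The set where \<open>f\<close> differs from \<open>c\<close> is open, and a nonempty open set is not a null set.
\<close>

lemma AE_eq_const_imp_eq:
  fixes f :: "real \<Rightarrow> real"
  assumes cont: "continuous_on {a<..<b} f" and ae: "AE t in lborel. t \<in> {a<..<b} \<longrightarrow> f t = c" and t: "t \<in> {a<..<b}"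
  shows "f t = c"
proof (rule ccontr)
  assume "f t \<noteq> c"
  let ?U = "{a<..<b} \<inter> f -` (- {c})"
  have "open ?U"
    using cont open_Compl[OF closed_singleton[of c]]
    by (intro continuous_open_preimage) auto
  moreover have "t \<in> ?U" using t \<open>f t \<noteq> c\<close> by simp
  ultimately have "\<not> negligible ?U" using open_not_negligible by blast
  moreover have "?U \<in> null_sets lborel"
  proof -
    have "?U \<in> sets lborel" using \<open>open ?U\<close> by simp
    moreover have "AE t in lborel. t \<notin> ?U" using ae by eventually_elim auto
    ultimately show ?thesis by (simp add: AE_iff_null_sets)
  qed
  then have "negligible ?U"
    by (simp add: negligible_iff_null_sets null_sets_completionI)
  ultimately show False by contradiction
qed

context closed_C1_param begin

lemma length_pos: "arc_length 1 > 0"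
proof -
  have "0 < dist (\<gamma> 0) (\<gamma> (1/2))" using curve_neq[of 0 "1/2"] by simp
  also have "\<dots> \<le> arc_length (1/2) - arc_length 0" by (rule dist_curve_le) auto
  also have "\<dots> \<le> arc_length 1" using arc_length_mono[of "1/2" 1] by (simp add: arc_length_def)
  finally show ?thesis .
qed

lemma length_shift: "closed_C1_param.arc_length (\<lambda>t. \<gamma> (s + t)) 1 = arc_length 1"
proof -
  interpret sh: closed_C1_param "\<lambda>t. \<gamma> (s + t)" by (rule shift)
  have "ennreal (sh.arc_length 1) = ennreal (arc_length 1)"
    using sh.emeasure_range_curve emeasure_range_curve range_shift by simp
  then show ?thesis using sh.length_pos length_pos by simp
qed

lemma nn_integral_speed: "(\<integral>\<^sup>+t\<in>{0<..<1}. ennreal (norm (V t)) \<partial>lborel) = ennreal (arc_length 1)"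
  using nn_integral_curve[of "\<lambda>_. 1" "\<lambda>_. 1"] emeasure_range_curve range_curve_borel
  by (simp add: nn_integral_indicator)

text \<open>
  The curvature of the round circle with the same length as \<open>\<gamma>\<close>.
\<close>

definition circle_curvature :: real where "circle_curvature = 2 * pi / arc_length 1"

lemma circle_curvature_pos: "circle_curvature > 0"
  using length_pos by (simp add: circle_curvature_def)

lemma continuous_tp_curvature: "continuous_on {0<..<1} (tp_curvature 0)"
  unfolding tp_curvature_def[abs_def] using chord_nz regular
  by (intro continuous_intros continuous_perp continuous_curve continuous_velocity) auto

text \<open>
  Integrate the tangent inequality of the power function at the value \<open>c\<close> along the curve: its linear
  term is controlled by lemma \<open>curvature_integral_ge\<close>, and \<open>c\<close> is chosen such that this bound is sharp for
  the constant function \<open>c\<close>. In the case of equality the integral of the defect \<open>D\<close> vanishes.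
\<close>

lemma tp_potential_0_minimum:
  assumes p: "p > 1"
  shows "ennreal (circle_curvature powr p * arc_length 1) \<le> tp_potential p 0"
    and "tp_potential p 0 = ennreal (circle_curvature powr p * arc_length 1) \<Longrightarrow>
         t \<in> {0<..<1} \<Longrightarrow> tp_curvature 0 t = circle_curvature"
proof -
  let ?c = circle_curvature
  note c = circle_curvature_pos
  define k where "k = p * ?c powr (p - 1)"
  define K where "K = (p - 1) * ?c powr p"
  define D where "D t = tp_curvature 0 t powr p + K - k * tp_curvature 0 t" for t
  let ?int = "\<lambda>f. \<integral>\<^sup>+t\<in>{0<..<1}. ennreal (f t) * ennreal (norm (V t)) \<partial>lborel"
  have [measurable]: "D \<in> borel_measurable borel"
    unfolding D_def[abs_def] by measurable
  have kK: "k \<ge> 0" "K \<ge> 0" using p c by (auto simp: k_def K_def)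
  have D_nonneg: "0 \<le> D t" for t
    using powr_above_tangent(1)[OF tp_curvature_nonneg c p, of 0 t] by (simp add: D_def k_def K_def)
  \<comment> \<open>For the constant function \<open>c\<close> the integrated tangent inequality is an equality.\<close>
  have k2: "k * (2 * pi) = ?c powr p * arc_length 1 + K * arc_length 1"
  proof -
    have "?c powr p = ?c powr (p - 1) * ?c" using c by (simp add: powr_diff)
    moreover have "?c * arc_length 1 = 2 * pi" using length_pos by (simp add: circle_curvature_def)
    ultimately show ?thesis by (simp add: k_def K_def algebra_simps)
  qed
  have eq: "tp_potential p 0 + ennreal (K * arc_length 1) = ?int D + ennreal k * ?int (tp_curvature 0)"
  proof -
    have "tp_potential p 0 + ennreal (K * arc_length 1)
        = ?int (\<lambda>t. tp_curvature 0 t powr p) + ennreal K * (\<integral>\<^sup>+t\<in>{0<..<1}. ennreal (norm (V t)) \<partial>lborel)"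
      using p kK length_pos by (simp add: tp_potential_0 nn_integral_speed ennreal_mult)
    also have "\<dots> = (\<integral>\<^sup>+t. ennreal (tp_curvature 0 t powr p) * ennreal (norm (V t)) * indicator {0<..<1} t
        + ennreal K * (ennreal (norm (V t)) * indicator {0<..<1} t) \<partial>lborel)"
      by (subst nn_integral_add) (measurable, simp add: nn_integral_cmult)
    also have "\<dots> = (\<integral>\<^sup>+t. ennreal (D t) * ennreal (norm (V t)) * indicator {0<..<1} t
        + ennreal k * (ennreal (tp_curvature 0 t) * ennreal (norm (V t)) * indicator {0<..<1} t) \<partial>lborel)"
    proof (rule nn_integral_cong)
      fix t
      have "ennreal (tp_curvature 0 t powr p) + ennreal K = ennreal (D t + k * tp_curvature 0 t)"
        using kK by (simp add: D_def)
      also have "\<dots> = ennreal (D t) + ennreal k * ennreal (tp_curvature 0 t)"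
        using D_nonneg kK by (simp add: ennreal_mult tp_curvature_nonneg)
      finally show "ennreal (tp_curvature 0 t powr p) * ennreal (norm (V t)) * indicator {0<..<1} t
        + ennreal K * (ennreal (norm (V t)) * indicator {0<..<1} t)
        = ennreal (D t) * ennreal (norm (V t)) * indicator {0<..<1} t
        + ennreal k * (ennreal (tp_curvature 0 t) * ennreal (norm (V t)) * indicator {0<..<1} t)"
        by (simp only: mult.assoc[symmetric] distrib_right[symmetric])
    qed
    also have "\<dots> = ?int D + ennreal k * ?int (tp_curvature 0)"
      by (subst nn_integral_add) (measurable, simp add: nn_integral_cmult)
    finally show ?thesis .
  qed
  have ge: "ennreal (?c powr p * arc_length 1) + ennreal (K * arc_length 1) \<le> ennreal k * ?int (tp_curvature 0)"
  proof -
    have "ennreal (?c powr p * arc_length 1) + ennreal (K * arc_length 1) = ennreal k * ennreal (2 * pi)"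
      using kK length_pos by (simp add: k2[symmetric] ennreal_mult[symmetric] ennreal_plus[symmetric] del: ennreal_plus)
    then show ?thesis using curvature_integral_ge by (simp add: mult_left_mono)
  qed
  have "ennreal (?c powr p * arc_length 1) + ennreal (K * arc_length 1) \<le> tp_potential p 0 + ennreal (K * arc_length 1)"
    using ge unfolding eq by (rule order_trans) simp
  then show "ennreal (?c powr p * arc_length 1) \<le> tp_potential p 0"
    by (cases "tp_potential p 0") (use kK length_pos in \<open>auto simp: ennreal_plus[symmetric] simp del: ennreal_plus\<close>)
  assume I: "tp_potential p 0 = ennreal (?c powr p * arc_length 1)" and t: "t \<in> {0<..<1}"
  let ?X = "ennreal k * ?int (tp_curvature 0)"
  \<comment> \<open>Cancelling \<open>?X\<close> in the extended reals requires that it is finite.\<close>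
  have "?int D + ?X \<le> 0 + ?X" using ge unfolding I[symmetric] eq by simp
  moreover have "?X \<noteq> top"
  proof -
    have "?int D + ?X = ennreal (?c powr p * arc_length 1) + ennreal (K * arc_length 1)" using eq I by simp
    then have "?int D + ?X \<noteq> top" by simp
    then show ?thesis by auto
  qed
  ultimately have "?int D \<le> 0"
    using ennreal_add_left_cancel_le[of ?X "?int D" 0] by (simp add: add.commute)
  then have "AE t in lborel. ennreal (D t) * ennreal (norm (V t)) * indicator {0<..<1} t = 0"
    by (subst nn_integral_0_iff_AE[symmetric]) auto
  then have "AE t in lborel. t \<in> {0<..<1} \<longrightarrow> tp_curvature 0 t = ?c"
  proof eventually_elim
    case (elim t)
    show ?case
    proof
      assume "t \<in> {0<..<1}"
      then have "D t = 0" using elim regular[of t] D_nonneg[of t] by (simp add: ennreal_eq_0_iff)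
      then show "tp_curvature 0 t = ?c"
        by (intro powr_above_tangent(2)[OF tp_curvature_nonneg c p]) (simp add: D_def k_def K_def)
    qed
  qed
  then show "tp_curvature 0 t = ?c"
    using AE_eq_const_imp_eq[OF continuous_tp_curvature _ t] by blast
qed

lemma circle_curvature_shift: "closed_C1_param.circle_curvature (\<lambda>t. \<gamma> (s + t)) = circle_curvature"
proof -
  interpret sh: closed_C1_param "\<lambda>t. \<gamma> (s + t)" by (rule shift)
  show ?thesis by (simp add: sh.circle_curvature_def circle_curvature_def length_shift)
qed

lemma tp_potential_ge:
  "p > 1 \<Longrightarrow> ennreal (circle_curvature powr p * arc_length 1) \<le> tp_potential p s"
proof -
  interpret sh: closed_C1_param "\<lambda>t. \<gamma> (s + t)" by (rule shift)
  show "p > 1 \<Longrightarrow> ?thesis"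
    using sh.tp_potential_0_minimum(1)[of p] by (simp add: circle_curvature_shift tp_potential_shift length_shift)
qed

lemma tp_potential_minimal:
  assumes "p > 1" "tp_potential p s = ennreal (circle_curvature powr p * arc_length 1)" "t \<in> {0<..<1}"
  shows "tp_curvature s (s + t) = circle_curvature"
proof -
  interpret sh: closed_C1_param "\<lambda>t. \<gamma> (s + t)" by (rule shift)
  show ?thesis
    using sh.tp_potential_0_minimum(2)[of p t] assms
    by (simp add: circle_curvature_shift tp_potential_shift length_shift tp_curvature_shift)
qed

lemma energy_ge:
  assumes p: "p > 1"
  shows "ennreal (circle_curvature powr p * (arc_length 1)\<^sup>2) \<le> tangent_point_energy p (range \<gamma>)"
proof -
  have "ennreal (circle_curvature powr p * (arc_length 1)\<^sup>2)
      = ennreal (circle_curvature powr p * arc_length 1) * (\<integral>\<^sup>+s\<in>{0<..<1}. ennreal (norm (V s)) \<partial>lborel)"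
    using length_pos by (simp add: nn_integral_speed ennreal_mult[symmetric] power2_eq_square)
  also have "\<dots> = (\<integral>\<^sup>+s. ennreal (circle_curvature powr p * arc_length 1) * (ennreal (norm (V s)) * indicator {0<..<1} s) \<partial>lborel)"
    by (rule nn_integral_cmult[symmetric]) measurable
  also have "\<dots> \<le> (\<integral>\<^sup>+s\<in>{0<..<1}. tp_potential p s * ennreal (norm (V s)) \<partial>lborel)"
    unfolding mult.assoc by (intro nn_integral_mono mult_right_mono tp_potential_ge p) simp
  finally show ?thesis using p by (simp add: tangent_point_energy_curve)
qed

text \<open>
  As every inner integral is at least the minimum, almost all of them attain it, and then the integrand
  is constant on the curve. Continuity in \<open>s\<close> removes the exceptional null set, also at the ends of the
  period.
\<close>

lemma energy_minimal_imp_curvature_const: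
  assumes p: "p > 1" and E: "tangent_point_energy p (range \<gamma>) = ennreal (circle_curvature powr p * (arc_length 1)\<^sup>2)"
    and s: "s \<in> {0..1}" and t: "t \<in> {0<..<1}"
  shows "tp_curvature s (s + t) = circle_curvature"
proof -
  let ?C = "ennreal (circle_curvature powr p * arc_length 1)"
  have [measurable]: "tp_potential p \<in> borel_measurable borel" using p by simp
  have "(\<integral>\<^sup>+s\<in>{0<..<1}. (tp_potential p s - ?C) * ennreal (norm (V s)) \<partial>lborel)
      + ennreal (circle_curvature powr p * (arc_length 1)\<^sup>2)
    = (\<integral>\<^sup>+s\<in>{0<..<1}. (tp_potential p s - ?C) * ennreal (norm (V s)) \<partial>lborel)
      + ?C * (\<integral>\<^sup>+s\<in>{0<..<1}. ennreal (norm (V s)) \<partial>lborel)"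
    using length_pos by (simp add: nn_integral_speed ennreal_mult[symmetric] power2_eq_square)
  also have "\<dots> = (\<integral>\<^sup>+s. (tp_potential p s - ?C) * ennreal (norm (V s)) * indicator {0<..<1} s
      + ?C * (ennreal (norm (V s)) * indicator {0<..<1} s) \<partial>lborel)"
    by (subst nn_integral_add) (measurable, simp add: nn_integral_cmult)
  also have "\<dots> = (\<integral>\<^sup>+s\<in>{0<..<1}. tp_potential p s * ennreal (norm (V s)) \<partial>lborel)"
  proof (rule nn_integral_cong)
    fix s
    have "tp_potential p s = (tp_potential p s - ?C) + ?C"
      using tp_potential_ge[OF p, of s] by (simp add: diff_add_cancel_ennreal)
    then have "tp_potential p s * ennreal (norm (V s)) * indicator {0<..<1} s
        = ((tp_potential p s - ?C) + ?C) * ennreal (norm (V s)) * indicator {0<..<1} s" by simp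
    then show "(tp_potential p s - ?C) * ennreal (norm (V s)) * indicator {0<..<1} s
      + ?C * (ennreal (norm (V s)) * indicator {0<..<1} s)
      = tp_potential p s * ennreal (norm (V s)) * indicator {0<..<1} s"
      by (simp only: mult.assoc[symmetric] distrib_right[symmetric])
  qed
  also have "\<dots> = 0 + ennreal (circle_curvature powr p * (arc_length 1)\<^sup>2)"
    using E p by (simp add: tangent_point_energy_curve)
  finally have "(\<integral>\<^sup>+s\<in>{0<..<1}. (tp_potential p s - ?C) * ennreal (norm (V s)) \<partial>lborel) = 0"
    by (subst (asm) (1 2) add.commute) (simp add: ennreal_add_left_cancel)
  then have "AE s in lborel. (tp_potential p s - ?C) * ennreal (norm (V s)) * indicator {0<..<1} s = 0"
    by (subst (asm) nn_integral_0_iff_AE) auto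
  then have ae: "AE s in lborel. s \<in> {0<..<1} \<longrightarrow> tp_curvature s (s + t) = circle_curvature"
  proof eventually_elim
    case (elim s)
    show ?case
    proof
      assume "s \<in> {0<..<1}"
      then have "tp_potential p s - ?C = 0" using elim regular[of s] by (simp add: ennreal_eq_0_iff)
      then have "tp_potential p s = ?C"
        using tp_potential_ge[OF p, of s] by (intro antisym) (simp_all add: diff_eq_0_iff_ennreal)
      then show "tp_curvature s (s + t) = circle_curvature" by (rule tp_potential_minimal[OF p _ t])
    qed
  qed
  have nz: "\<gamma> (s + t) - \<gamma> s \<noteq> 0" for s using curve_neq[of "s + t" s] t by simp
  have cont: "continuous_on S (\<lambda>s. tp_curvature s (s + t))" for S
    unfolding tp_curvature_def using nz regular
    by (intro continuous_intros continuous_perp continuous_on_compose2[OF continuous_curve[of UNIV]]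
        continuous_on_compose2[OF continuous_velocity[of UNIV]]) auto
  have "tp_curvature s (s + t) = circle_curvature" if "s \<in> {0<..<1}" for s
    by (rule AE_eq_const_imp_eq[OF cont ae that])
  then show ?thesis
    using continuous_constant_on_closure[of "{0<..<1}" "\<lambda>s. tp_curvature s (s + t)" circle_curvature s] cont s
    by simp
qed

lemma energy_eq_of_const_curvature:
  assumes p: "p > 1" and const: "\<And>s t. t \<in> {0<..<1} \<Longrightarrow> tp_curvature s (s + t) = circle_curvature"
  shows "tangent_point_energy p (range \<gamma>) = ennreal (circle_curvature powr p * (arc_length 1)\<^sup>2)"
proof -
  let ?c = "ennreal (circle_curvature powr p)"
  have I: "tp_potential p s = ?c * ennreal (arc_length 1)" for s
  proof -
    interpret sh: closed_C1_param "\<lambda>t. \<gamma> (s + t)" by (rule shift)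
    have "tp_potential p s = (\<integral>\<^sup>+t. ?c * (ennreal (norm (V (s + t))) * indicator {0<..<1} t) \<partial>lborel)"
      using p unfolding tp_potential_eq[OF less_trans[OF zero_less_one p]]
      by (intro nn_integral_cong) (simp add: const indicator_def)
    also have "\<dots> = ?c * (\<integral>\<^sup>+t\<in>{0<..<1}. ennreal (norm (V (s + t))) \<partial>lborel)"
      by (rule nn_integral_cmult) (use sh.borel_measurable_curve(2) in \<open>simp add: velocity_shift\<close>)
    also have "\<dots> = ?c * ennreal (arc_length 1)"
      using sh.nn_integral_speed by (simp add: velocity_shift length_shift)
    finally show ?thesis .
  qed
  have "tangent_point_energy p (range \<gamma>)
      = (\<integral>\<^sup>+s. ?c * ennreal (arc_length 1) * (ennreal (norm (V s)) * indicator {0<..<1} s) \<partial>lborel)"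
    using p by (simp add: tangent_point_energy_curve I mult.assoc)
  also have "\<dots> = ?c * ennreal (arc_length 1) * ennreal (arc_length 1)"
    by (subst nn_integral_cmult) (measurable, simp add: nn_integral_speed)
  also have "\<dots> = ennreal (circle_curvature powr p * (arc_length 1)\<^sup>2)"
    using length_pos by (simp add: ennreal_mult power2_eq_square mult.assoc)
  finally show ?thesis .
qed

lemma ennpowr_length: "ennpowr (emeasure hausdorff1 (range \<gamma>)) a = ennreal (arc_length 1 powr a)"
  using length_pos by (simp add: ennpowr_def emeasure_range_curve)

text \<open>
  The right-hand side \<open>X\<close> is a strictly increasing function of the energy, which takes the value \<open>2 \<pi>\<close>
  exactly at the lower bound \<open>c\<^sup>p L\<^sup>2\<close>.
\<close>

lemma two_pi_le_energy_length:
  assumes p: "p > 1"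
  defines "X \<equiv> ennpowr (tangent_point_energy p (range \<gamma>)) (1 / p) * ennpowr (emeasure hausdorff1 (range \<gamma>)) (1 - 2 / p)"
  shows "ennreal (2 * pi) \<le> X"
    and "ennreal (2 * pi) = X \<longleftrightarrow> tangent_point_energy p (range \<gamma>) = ennreal (circle_curvature powr p * (arc_length 1)\<^sup>2)"
proof -
  let ?E = "tangent_point_energy p (range \<gamma>)"
  define m where "m = circle_curvature powr p * (arc_length 1)\<^sup>2"
  note L = length_pos and c = circle_curvature_pos
  have m: "m > 0" using L c by (simp add: m_def)
  have two_pi: "2 * pi = m powr (1 / p) * arc_length 1 powr (1 - 2 / p)"
  proof -
    have L2: "(arc_length 1)\<^sup>2 = arc_length 1 powr 2" using L by simp
    have "m powr (1 / p) = (circle_curvature powr p) powr (1 / p) * (arc_length 1 powr 2) powr (1 / p)"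
      unfolding m_def L2 by (rule powr_mult)
    also have "\<dots> = circle_curvature * arc_length 1 powr (2 / p)"
      unfolding powr_powr using c p by simp
    finally have "m powr (1 / p) * arc_length 1 powr (1 - 2 / p) = circle_curvature * (arc_length 1 powr (2 / p) * arc_length 1 powr (1 - 2 / p))"
      by simp
    also have "\<dots> = circle_curvature * arc_length 1" using L by (simp flip: powr_add)
    also have "\<dots> = 2 * pi" using L by (simp add: circle_curvature_def)
    finally show ?thesis by simp
  qed
  have "ennreal (2 * pi) \<le> X \<and> (ennreal (2 * pi) = X \<longleftrightarrow> ?E = ennreal m)"
  proof (cases "?E = \<infinity>")
    case True
    then have "ennpowr ?E (1 / p) = \<infinity>" using p by (simp add: ennpowr_def)
    then have "X = \<infinity>" using L by (simp add: X_def ennpowr_length ennreal_top_mult)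
    then show ?thesis using True by simp
  next
    case False
    then obtain e where e: "?E = ennreal e" "e \<ge> 0" by (cases ?E) auto
    have "m \<le> e" using energy_ge[OF p] e by (simp add: m_def)
    then have "e > 0" using m by simp
    then have "ennpowr ?E (1 / p) = ennreal (e powr (1 / p))"
      using p e by (simp add: ennpowr_def)
    then have X: "X = ennreal (e powr (1 / p) * arc_length 1 powr (1 - 2 / p))"
      by (simp add: X_def ennpowr_length ennreal_mult)
    have "2 * pi \<le> e powr (1 / p) * arc_length 1 powr (1 - 2 / p)"
      unfolding two_pi using \<open>m \<le> e\<close> m p by (intro mult_right_mono powr_mono2) auto
    moreover have "2 * pi < e powr (1 / p) * arc_length 1 powr (1 - 2 / p)" if "m < e"
      unfolding two_pi using that m p L by (intro mult_strict_right_mono powr_less_mono2) auto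
    ultimately show ?thesis
      using \<open>m \<le> e\<close> m \<open>e > 0\<close> unfolding X e(1) by (cases "m = e") (auto simp: two_pi ennreal_leI)
  qed
  then show "ennreal (2 * pi) \<le> X" "ennreal (2 * pi) = X \<longleftrightarrow> ?E = ennreal (circle_curvature powr p * (arc_length 1)\<^sup>2)"
    by (auto simp: m_def)
qed

section \<open>The case of equality\<close>

text \<open>
  The first assumption says that the path of directions has speed \<open>c \<bar>\<gamma>'\<bar> / 2\<close> and hence length \<open>\<pi>\<close>, the
  second one relates the length of the chord to its angle with the initial tangent. The former makes
  that path half of a great circle through \<^term>\<open>init_dir\<close> and a unit normal \<open>n\<close>, traversed such that the
  angle \<open>\<theta>\<close> is half of the central angle \<open>c arc_length t\<close> (the inscribed angle theorem).
\<close>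

lemma curvature_const_imp_circular:
  assumes k0: "\<And>t. t \<in> {0<..<1} \<Longrightarrow> tp_curvature 0 t = circle_curvature"
    and k1: "\<And>t. t \<in> {0<..<1} \<Longrightarrow> tp_curvature t 1 = circle_curvature"
  obtains n where "norm n = 1" "n \<bullet> init_dir = 0"
    "\<And>t. t \<in> {0..<1} \<Longrightarrow> \<gamma> t = \<gamma> 0 + (1 / circle_curvature) *\<^sub>R n
       + (1 / circle_curvature) *\<^sub>R (sin (circle_curvature * arc_length t) *\<^sub>R init_dir - cos (circle_curvature * arc_length t) *\<^sub>R n)"
proof -
  define c where "c = circle_curvature"
  have c: "c > 0" using circle_curvature_pos by (simp add: c_def)
  have cL: "c * arc_length 1 = 2 * pi" using length_pos by (simp add: c_def circle_curvature_def)
  define \<theta> where "\<theta> t = c * arc_length t / 2" for t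
  have init_dir: "init_dir \<bullet> init_dir = 1" using norm_init_dir by (simp add: norm_eq_1)
  have speed: "dir_speed t = c * norm (V t) / 2" if "t \<in> {0<..<1}" for t
    using dir_speed_eq[OF that] k0[OF that] by (simp add: c_def)
  have chord_sin: "1 - (dir t \<bullet> init_dir)\<^sup>2 = (c * norm (chord t) / 2)\<^sup>2" if t: "t \<in> {0<..<1}" for t
  proof -
    have "perp (V 0) (- chord t) = - perp (V 0) (chord t)"
      using perp_scaleR[of "V 0" "-1" "chord t"] by simp
    then have "norm (perp (V 0) (chord t)) = c * (norm (chord t))\<^sup>2 / 2"
      using k1[OF t] chord_nz[OF t]
      by (simp add: tp_curvature_def c_def velocity_1 curve_1 norm_minus_commute field_simps)
    then have "(c * (norm (chord t))\<^sup>2 / 2)\<^sup>2 = (norm (chord t))\<^sup>2 - (chord t \<bullet> V 0)\<^sup>2 / (V 0 \<bullet> V 0)"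
      using norm_perp_squared[of "V 0" "chord t"] by (simp only:)
    moreover have "(chord t \<bullet> V 0)\<^sup>2 / (V 0 \<bullet> V 0) = (norm (chord t))\<^sup>2 * (dir t \<bullet> init_dir)\<^sup>2"
    proof -
      have "dir t \<bullet> init_dir = (chord t \<bullet> V 0) / (norm (chord t) * norm (V 0))"
        unfolding dir_def init_dir_def inner_scaleR_left inner_scaleR_right by (simp add: divide_inverse)
      then show ?thesis using chord_nz[OF t]
        by (simp add: power_divide power_mult_distrib power2_norm_eq_inner[of "V 0"])
    qed
    ultimately have "(norm (chord t))\<^sup>2 * (1 - (dir t \<bullet> init_dir)\<^sup>2) = (norm (chord t))\<^sup>2 * (c * norm (chord t) / 2)\<^sup>2"
      by (simp add: power2_eq_square algebra_simps)
    then show ?thesis using chord_nz[OF t] by simp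
  qed
  have arc_length_D: "(arc_length has_real_derivative norm (V t)) (at t)" if t: "t \<in> {0<..<1}" for t
    using arc_length_has_derivative[of t] t at_within_interior[of t "{0..1}"] by simp
  have \<theta>_D: "(\<theta> has_real_derivative dir_speed t) (at t)" if t: "t \<in> {0<..<1}" for t
    unfolding \<theta>_def[abs_def] speed[OF t] using arc_length_D[OF t] by (auto intro!: derivative_eq_intros)
  have \<theta>_lim: "(\<theta> \<longlongrightarrow> 0) (at_right 0)" "(\<theta> \<longlongrightarrow> pi) (at_left 1)"
  proof -
    have "continuous_on {0..1} \<theta>" unfolding \<theta>_def[abs_def] by (intro continuous_intros continuous_arc_length) simp
    then have "(\<theta> \<longlongrightarrow> \<theta> 0) (at_right 0)" "(\<theta> \<longlongrightarrow> \<theta> 1) (at_left 1)"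
      by (auto intro: continuous_on_Icc_at_rightD continuous_on_Icc_at_leftD)
    then show "(\<theta> \<longlongrightarrow> 0) (at_right 0)" "(\<theta> \<longlongrightarrow> pi) (at_left 1)"
      using cL by (auto simp: \<theta>_def arc_length_def)
  qed
  have sin_pos: "1 - (dir t \<bullet> init_dir)\<^sup>2 > 0" if t: "t \<in> {0<..<1}" for t
    using chord_sin[OF t] chord_nz[OF t] c by simp
  \<comment> \<open>The difference of the length of the path of directions up to \<open>t\<close> and the angle it has covered, up to the
    constant \<open>\<pi> / 2\<close>. It never decreases and has the same limit at both ends, as the total length \<open>\<pi>\<close> is
    the angle between the end points; so no length is wasted.\<close>
  define K where "K t = \<theta> t + arcsin (dir t \<bullet> init_dir)" for t
  have K_D: "\<exists>d. (K has_real_derivative d) (at t) \<and> 0 \<le> d" if t: "t \<in> {0<..<1}" for t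
  proof -
    define g' where "g' = (perp (chord t) (V t) /\<^sub>R norm (chord t)) \<bullet> init_dir"
    have g: "-1 < dir t \<bullet> init_dir" "dir t \<bullet> init_dir < 1"
      using sin_pos[OF t] abs_square_less_1[of "dir t \<bullet> init_dir"] by (auto simp: abs_less_iff)
    have "(K has_real_derivative dir_speed t + g' / sqrt (1 - (dir t \<bullet> init_dir)\<^sup>2)) (at t)"
      unfolding K_def[abs_def] using g \<theta>_D[OF t] dir_inner_has_derivative[OF t]
      by (auto intro!: derivative_eq_intros simp: g'_def divide_inverse)
    moreover have "0 \<le> dir_speed t + g' / sqrt (1 - (dir t \<bullet> init_dir)\<^sup>2)"
    proof -
      define \<sigma> where "\<sigma> = sqrt (1 - (dir t \<bullet> init_dir)\<^sup>2)"
      have "\<sigma> > 0" using sin_pos[OF t] by (simp add: \<sigma>_def)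
      have "0 \<le> dir_speed t * \<sigma> + g'"
        using dir_inner_derivative_le[OF t] unfolding g'_def \<sigma>_def by linarith
      then have "0 \<le> (dir_speed t * \<sigma> + g') / \<sigma>" using \<open>\<sigma> > 0\<close> by simp
      then show ?thesis using \<open>\<sigma> > 0\<close> unfolding \<sigma>_def[symmetric] by (simp add: add_divide_distrib)
    qed
    ultimately show ?thesis by blast
  qed
  have K_mono: "K s \<le> K t" if "0 < s" "s \<le> t" "t < 1" for s t
    using that(2)
  proof (rule DERIV_nonneg_imp_nondecreasing)
    show "\<exists>d. (K has_real_derivative d) (at x) \<and> 0 \<le> d" if "s \<le> x" "x \<le> t" for x
      using K_D[of x] that \<open>0 < s\<close> \<open>t < 1\<close> by simp
  qed
  have K_eq: "K t = pi / 2" if t: "t \<in> {0<..<1}" for t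
  proof (rule antisym)
    have K0: "(K \<longlongrightarrow> pi / 2) (at_right 0)"
      using tendsto_add[OF \<theta>_lim(1) arcsin_dir_tendsto(1)] by (simp add: K_def[abs_def])
    have K1: "(K \<longlongrightarrow> pi / 2) (at_left 1)"
      using tendsto_add[OF \<theta>_lim(2) arcsin_dir_tendsto(2)] by (simp add: K_def[abs_def])
    have "\<forall>\<^sub>F s in at_right 0. s \<in> {0<..<t}" using eventually_at_right_real[of 0 t] t by simp
    then have "\<forall>\<^sub>F s in at_right 0. K s \<le> K t"
      by (rule eventually_mono) (use t in \<open>simp add: K_mono\<close>)
    then show "pi / 2 \<le> K t" by (rule tendsto_upperbound[OF K0]) simp
    have "\<forall>\<^sub>F s in at_left 1. s \<in> {t<..<1}" using eventually_at_left_real[of t 1] t by simp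
    then have "\<forall>\<^sub>F s in at_left 1. K t \<le> K s"
      by (rule eventually_mono) (use t in \<open>simp add: K_mono\<close>)
    then show "K t \<le> pi / 2" by (rule tendsto_lowerbound[OF K1]) simp
  qed
  have cos_\<theta>: "dir t \<bullet> init_dir = cos (\<theta> t)" if t: "t \<in> {0<..<1}" for t
  proof -
    have "arcsin (dir t \<bullet> init_dir) = pi / 2 - \<theta> t" using K_eq[OF t] by (simp add: K_def)
    then have "sin (arcsin (dir t \<bullet> init_dir)) = sin (pi / 2 - \<theta> t)" by simp
    then show ?thesis using dir_inner_bounds[OF t] by (simp add: sin_diff)
  qed
  have sin_\<theta>: "sin (\<theta> t) = c * norm (chord t) / 2" "sin (\<theta> t) > 0" if t: "t \<in> {0<..<1}" for t
  proof -
    have "0 \<le> arc_length t" "arc_length t \<le> arc_length 1" using arc_length_mono[of 0 t] arc_length_mono[of t 1] t by (auto simp: arc_length_def)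
    then have "0 \<le> \<theta> t" "c * arc_length t \<le> c * arc_length 1" using c by (auto simp: \<theta>_def)
    then have "0 \<le> sin (\<theta> t)" using cL by (intro sin_ge_zero) (auto simp: \<theta>_def)
    moreover have "(sin (\<theta> t))\<^sup>2 = (c * norm (chord t) / 2)\<^sup>2"
      using chord_sin[OF t] by (simp add: sin_squared_eq cos_\<theta>[OF t])
    moreover have "0 < c * norm (chord t) / 2" using c chord_nz[OF t] by simp
    ultimately show "sin (\<theta> t) = c * norm (chord t) / 2" "sin (\<theta> t) > 0"
      by (auto simp: power2_eq_iff_nonneg)
  qed
  \<comment> \<open>The unit vector orthogonal to the initial tangent in the plane of that tangent and the chord.
    The plane does not rotate, because all the speed of the path of directions goes into the angle \<open>\<theta>\<close>.\<close>
  define n where "n t = (1 / sin (\<theta> t)) *\<^sub>R (dir t - cos (\<theta> t) *\<^sub>R init_dir)" for t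
  have n_D: "(n has_vector_derivative 0) (at t)" if t: "t \<in> {0<..<1}" for t
  proof -
    define q where "q = dir_speed t"
    define S where "S = sin (\<theta> t)"
    define C where "C = cos (\<theta> t)"
    define d where "d = perp (chord t) (V t) /\<^sub>R norm (chord t)"
    have S: "S > 0" and SC: "S\<^sup>2 + C\<^sup>2 = 1" using sin_\<theta>(2)[OF t] by (simp_all add: S_def C_def)
    have dir_D: "(dir has_vector_derivative d) (at t)" unfolding d_def by (rule dir_has_derivative[OF t])
    have cos_D: "((\<lambda>t. cos (\<theta> t)) has_real_derivative - (S * q)) (at t)"
      using \<theta>_D[OF t] by (auto intro!: derivative_eq_intros simp: S_def q_def)
    have inv_D: "((\<lambda>t. 1 / sin (\<theta> t)) has_real_derivative - (C * q) / S\<^sup>2) (at t)"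
      using \<theta>_D[OF t] S by (auto intro!: derivative_eq_intros simp: S_def q_def C_def power2_eq_square)
    have "((\<lambda>t. cos (\<theta> t) *\<^sub>R init_dir) has_vector_derivative (- (S * q)) *\<^sub>R init_dir) (at t)"
      using has_vector_derivative_scaleR[OF cos_D has_vector_derivative_const[of init_dir]] by simp
    from has_vector_derivative_diff[OF dir_D this]
    have diff_D: "((\<lambda>t. dir t - cos (\<theta> t) *\<^sub>R init_dir) has_vector_derivative d - (- (S * q)) *\<^sub>R init_dir) (at t)" .
    have "d \<bullet> init_dir = - (S * q)"
    proof (rule DERIV_unique[OF _ cos_D])
      show "((\<lambda>t. cos (\<theta> t)) has_real_derivative d \<bullet> init_dir) (at t)"
        using dir_inner_has_derivative[OF t] unfolding d_def
        by (rule has_field_derivative_transform_within_open[of _ _ _ "{0<..<1}"]) (use t cos_\<theta> in auto)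
    qed
    have d_norm: "norm d = q" by (simp add: d_def q_def dir_speed_def divide_inverse mult.commute)
    have d_dir: "d \<bullet> dir t = 0" by (simp add: d_def dir_def)
    have n1: "norm (C *\<^sub>R dir t - init_dir) = S"
    proof -
      have "(norm (C *\<^sub>R dir t - init_dir))\<^sup>2 = 1 - C\<^sup>2"
        using norm_dir[OF t] init_dir cos_\<theta>[OF t] unfolding power2_norm_eq_inner
        by (simp add: inner_diff_left inner_diff_right inner_commute norm_eq_1 C_def power2_eq_square)
      also have "\<dots> = S\<^sup>2" using SC by simp
      finally show ?thesis using S by (simp add: power2_eq_iff_nonneg)
    qed
    \<comment> \<open>Equality in the Cauchy-Schwarz inequality determines the direction of the velocity \<open>d\<close>.\<close>
    have "d \<bullet> (C *\<^sub>R dir t - init_dir) = norm d * norm (C *\<^sub>R dir t - init_dir)"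
      using \<open>d \<bullet> init_dir = - (S * q)\<close> d_dir by (simp add: inner_diff_right d_norm n1)
    then have "norm d *\<^sub>R (C *\<^sub>R dir t - init_dir) = norm (C *\<^sub>R dir t - init_dir) *\<^sub>R d"
      by (rule norm_cauchy_schwarz_eq[THEN iffD1])
    then have "q *\<^sub>R (C *\<^sub>R dir t - init_dir) = S *\<^sub>R d"
      unfolding d_norm n1 .
    then have "(1 / S) *\<^sub>R (q *\<^sub>R (C *\<^sub>R dir t - init_dir)) = (1 / S) *\<^sub>R (S *\<^sub>R d)" by simp
    then have d_eq: "d = (q * C / S) *\<^sub>R dir t - (q / S) *\<^sub>R init_dir"
      using S by (simp add: scaleR_diff_right)
    have "(n has_vector_derivative ((1 / S) *\<^sub>R (d - (- (S * q)) *\<^sub>R init_dir) + (- (C * q) / S\<^sup>2) *\<^sub>R (dir t - C *\<^sub>R init_dir))) (at t)"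
      unfolding n_def[abs_def] S_def C_def
      by (rule has_vector_derivative_scaleR[OF inv_D[unfolded S_def C_def]])
         (rule diff_D[unfolded S_def])
    moreover have "(1 / S) *\<^sub>R (d - (- (S * q)) *\<^sub>R init_dir) + (- (C * q) / S\<^sup>2) *\<^sub>R (dir t - C *\<^sub>R init_dir)
        = ((1 / S) * (q * C / S) - C * q / S\<^sup>2) *\<^sub>R dir t + ((1 / S) * (- (q / S) + S * q) + C * q / S\<^sup>2 * C) *\<^sub>R init_dir"
      unfolding d_eq by (simp add: algebra_simps)
    moreover have "(1 / S) * (q * C / S) - C * q / S\<^sup>2 = 0" using S by (simp add: power2_eq_square)
    moreover have "(1 / S) * (- (q / S) + S * q) + C * q / S\<^sup>2 * C = 0"
    proof -
      have "(1 / S) * (- (q / S) + S * q) + C * q / S\<^sup>2 * C = q * (S\<^sup>2 + C\<^sup>2 - 1) / S\<^sup>2"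
        using S by (simp add: field_simps power2_eq_square)
      then show ?thesis using SC by simp
    qed
    ultimately show ?thesis by simp
  qed
  have "(n has_vector_derivative 0) (at t within {0<..<1})" if "t \<in> {0<..<1}" for t
    by (rule has_vector_derivative_at_within[OF n_D[OF that]])
  then obtain n0 where n0: "\<And>t. t \<in> {0<..<1} \<Longrightarrow> n t = n0"
    using has_vector_derivative_zero_constant[of "{0<..<1}" n] by (metis convex_real_interval(8))
  have dir_eq: "dir t = cos (\<theta> t) *\<^sub>R init_dir + sin (\<theta> t) *\<^sub>R n0" if t: "t \<in> {0<..<1}" for t
    using n0[OF t] sin_\<theta>(2)[OF t] by (auto simp: n_def)
  have half: "(1/2::real) \<in> {0<..<1}" by simp
  show thesis
  proof (rule that[of n0])
    have "(dir (1/2) - cos (\<theta> (1/2)) *\<^sub>R init_dir) \<bullet> init_dir = 0"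
      using cos_\<theta>[OF half] init_dir by (simp add: inner_diff_left)
    then show "n0 \<bullet> init_dir = 0" unfolding n0[OF half, symmetric] n_def by simp
    have "(norm (dir (1/2) - cos (\<theta> (1/2)) *\<^sub>R init_dir))\<^sup>2 = (sin (\<theta> (1/2)))\<^sup>2"
      using norm_dir[OF half] init_dir cos_\<theta>[OF half] sin_squared_eq[of "\<theta> (1/2)"]
      unfolding power2_norm_eq_inner
      by (simp add: inner_diff_left inner_diff_right inner_commute norm_eq_1 power2_eq_square)
    then have "norm (dir (1/2) - cos (\<theta> (1/2)) *\<^sub>R init_dir) = sin (\<theta> (1/2))"
      using sin_\<theta>(2)[OF half] by (simp add: power2_eq_iff_nonneg)
    then show "norm n0 = 1" unfolding n0[OF half, symmetric] n_def using sin_\<theta>(2)[OF half] by simp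
    fix t :: real assume t: "t \<in> {0..<1}"
    have "chord t = (1 / c) *\<^sub>R n0 + (1 / c) *\<^sub>R (sin (c * arc_length t) *\<^sub>R init_dir - cos (c * arc_length t) *\<^sub>R n0)"
    proof (cases "t = 0")
      case True
      then show ?thesis by (simp add: arc_length_def)
    next
      case False
      then have t: "t \<in> {0<..<1}" using t by simp
      have two: "c * arc_length t = 2 * \<theta> t" by (simp add: \<theta>_def)
      have "chord t = norm (chord t) *\<^sub>R dir t" using chord_nz[OF t] by (simp add: dir_def)
      also have "norm (chord t) = 2 * sin (\<theta> t) / c" using sin_\<theta>(1)[OF t] c by (simp add: field_simps)
      also have "(2 * sin (\<theta> t) / c) *\<^sub>R dir t
          = (2 * sin (\<theta> t) * cos (\<theta> t) / c) *\<^sub>R init_dir + (2 * (sin (\<theta> t))\<^sup>2 / c) *\<^sub>R n0"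
        unfolding dir_eq[OF t] by (simp add: scaleR_add_right power2_eq_square)
      also have "2 * sin (\<theta> t) * cos (\<theta> t) = sin (c * arc_length t)" unfolding two by (simp add: sin_double)
      also have "2 * (sin (\<theta> t))\<^sup>2 = 1 - cos (c * arc_length t)" unfolding two by (simp add: cos_double_sin)
      finally show ?thesis
        by (simp add: scaleR_diff_right scaleR_diff_left diff_divide_distrib)
    qed
    then show "\<gamma> t = \<gamma> 0 + (1 / circle_curvature) *\<^sub>R n0
       + (1 / circle_curvature) *\<^sub>R (sin (circle_curvature * arc_length t) *\<^sub>R init_dir - cos (circle_curvature * arc_length t) *\<^sub>R n0)"
      unfolding c_def[symmetric] by (simp add: algebra_simps)
  qed
qed

end

section \<open>Round circles\<close>

lemma plane_eq_span:
  fixes u v :: "'a::euclidean_space"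
  assumes "norm u = 1" "norm v = 1" "u \<bullet> v = 0"
  shows "affine ((+) a ` span {u, v})" "aff_dim ((+) a ` span {u, v}) = 2" "a \<in> (+) a ` span {u, v}"
proof -
  show "affine ((+) a ` span {u, v})"
    using affine_translation[of "span {u, v}" a] subspace_imp_affine[OF subspace_span] by blast
  have "u \<noteq> v" using assms by (auto simp: norm_eq_1)
  moreover have "independent {u, v}"
    using assms by (intro pairwise_orthogonal_independent) (auto simp: pairwise_def orthogonal_def inner_commute)
  ultimately have "dim (span {u, v}) = 2" by (simp add: dim_eq_card_independent)
  then show "aff_dim ((+) a ` span {u, v}) = 2"
    by (simp add: aff_dim_translation_eq aff_dim_subspace)
  show "a \<in> (+) a ` span {u, v}" by (rule image_eqI[of _ _ 0]) (auto simp: span_zero)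
qed

lemma sphere_Int_plane:
  fixes u v :: "'a::euclidean_space"
  assumes uv: "norm u = 1" "norm v = 1" "u \<bullet> v = 0" and r: "r > 0"
  shows "sphere a r \<inter> (+) a ` span {u, v} = range (\<lambda>\<phi>. a + r *\<^sub>R (cos \<phi> *\<^sub>R u + sin \<phi> *\<^sub>R v))"
proof -
  have sq: "(norm (\<alpha> *\<^sub>R u + \<beta> *\<^sub>R v))\<^sup>2 = \<alpha>\<^sup>2 + \<beta>\<^sup>2" for \<alpha> \<beta>
    using uv unfolding power2_norm_eq_inner
    by (simp add: inner_add_left inner_add_right inner_commute norm_eq_1 power2_eq_square)
  have span: "x \<in> span {u, v} \<longleftrightarrow> (\<exists>\<alpha> \<beta>. x = \<alpha> *\<^sub>R u + \<beta> *\<^sub>R v)" for x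
    unfolding span_insert[of u] span_singleton by (simp add: image_iff diff_eq_eq add.commute)
  show ?thesis
  proof (intro equalityI subsetI)
    fix x assume "x \<in> sphere a r \<inter> (+) a ` span {u, v}"
    then obtain \<alpha> \<beta> where x: "x = a + (\<alpha> *\<^sub>R u + \<beta> *\<^sub>R v)" and "dist a x = r"
      by (auto simp: span)
    then have "norm (\<alpha> *\<^sub>R u + \<beta> *\<^sub>R v) = r"
      using \<open>dist a x = r\<close> by (metis add_diff_cancel_left' dist_commute dist_norm)
    then have "\<alpha>\<^sup>2 + \<beta>\<^sup>2 = r\<^sup>2" using sq[of \<alpha> \<beta>] by simp
    then have "(\<alpha> / r)\<^sup>2 + (\<beta> / r)\<^sup>2 = 1"
      using r by (simp add: power_divide add_divide_distrib[symmetric])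
    then obtain \<phi> where "\<alpha> / r = cos \<phi>" "\<beta> / r = sin \<phi>" by (rule sincos_total_2pi)
    then have "\<alpha> = r * cos \<phi>" "\<beta> = r * sin \<phi>" using r by (simp_all add: field_simps)
    then have "x = a + r *\<^sub>R (cos \<phi> *\<^sub>R u + sin \<phi> *\<^sub>R v)" by (simp add: x scaleR_add_right)
    then show "x \<in> range (\<lambda>\<phi>. a + r *\<^sub>R (cos \<phi> *\<^sub>R u + sin \<phi> *\<^sub>R v))" by (rule range_eqI)
  next
    fix x assume "x \<in> range (\<lambda>\<phi>. a + r *\<^sub>R (cos \<phi> *\<^sub>R u + sin \<phi> *\<^sub>R v))"
    then obtain \<phi> where x: "x = a + r *\<^sub>R (cos \<phi> *\<^sub>R u + sin \<phi> *\<^sub>R v)" by (elim rangeE)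
    have "norm (cos \<phi> *\<^sub>R u + sin \<phi> *\<^sub>R v) = 1"
      by (rule power2_eq_imp_eq) (simp_all add: sq)
    then have "x \<in> sphere a r" using r by (simp add: x dist_norm)
    moreover have "x \<in> (+) a ` span {u, v}"
      unfolding x by (intro imageI span_scale span_add span_base) auto
    ultimately show "x \<in> sphere a r \<inter> (+) a ` span {u, v}" by blast
  qed
qed

context closed_C1_param begin

text \<open>
  The centre lies at distance \<open>1 / c\<close> from \<open>\<gamma> 0\<close> in the normal direction. The whole circle is covered as the
  central angle \<open>c arc_length t\<close> runs continuously from \<open>0\<close> to \<open>2 \<pi>\<close>.
\<close>

lemma curvature_const_imp_round_circle:
  assumes k0: "\<And>t. t \<in> {0<..<1} \<Longrightarrow> tp_curvature 0 t = circle_curvature"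
    and k1: "\<And>t. t \<in> {0<..<1} \<Longrightarrow> tp_curvature t 1 = circle_curvature"
  shows "round_circle (range \<gamma>)"
proof -
  let ?c = circle_curvature
  note c = circle_curvature_pos
  obtain n where n: "norm n = 1" "n \<bullet> init_dir = 0" and \<gamma>: "\<And>t. t \<in> {0..<1} \<Longrightarrow> \<gamma> t = \<gamma> 0 + (1 / ?c) *\<^sub>R n
       + (1 / ?c) *\<^sub>R (sin (?c * arc_length t) *\<^sub>R init_dir - cos (?c * arc_length t) *\<^sub>R n)"
    using curvature_const_imp_circular[OF k0 k1] by blast
  define a where "a = \<gamma> 0 + (1 / ?c) *\<^sub>R n"
  let ?z = "\<lambda>\<phi>. a + (1 / ?c) *\<^sub>R (cos \<phi> *\<^sub>R (- n) + sin \<phi> *\<^sub>R init_dir)"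
  have uv: "norm (- n) = 1" "norm init_dir = 1" "(- n) \<bullet> init_dir = 0" using n norm_init_dir by auto
  have \<gamma>z: "\<gamma> t = ?z (?c * arc_length t)" if "t \<in> {0..<1}" for t
    using \<gamma>[OF that] by (simp add: a_def)
  have "range \<gamma> = range ?z"
  proof (intro equalityI subsetI)
    fix x assume "x \<in> range \<gamma>"
    then obtain t where "t \<in> {0..<1}" "x = \<gamma> t" unfolding range_curve by (elim imageE)
    then have "x = ?z (?c * arc_length t)" using \<gamma>z by simp
    then show "x \<in> range ?z" by (rule range_eqI)
  next
    fix x assume "x \<in> range ?z"
    then obtain \<phi> where x: "x = ?z \<phi>" by (elim rangeE)
    obtain \<psi> where \<psi>: "0 \<le> \<psi>" "\<psi> < 2 * pi" "cos \<phi> = cos \<psi>" "sin \<phi> = sin \<psi>"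
      by (rule sincos_total_2pi[of "cos \<phi>" "sin \<phi>"]) simp
    have cL: "?c * arc_length 1 = 2 * pi" using length_pos by (simp add: circle_curvature_def)
    have "\<psi> / ?c \<le> arc_length 1" "0 \<le> \<psi> / ?c" using c cL \<psi> by (simp_all add: pos_divide_le_eq mult.commute)
    then obtain t where t: "0 \<le> t" "t \<le> 1" "arc_length t = \<psi> / ?c"
      using IVT'[of arc_length 0 "\<psi> / ?c" 1] continuous_arc_length by (auto simp: arc_length_def)
    then have central_angle: "?c * arc_length t = \<psi>" using c by simp
    then have "t \<noteq> 1" using cL \<psi>(2) by auto
    then have "\<gamma> t = ?z \<psi>" using \<gamma>z[of t] t central_angle by simp
    then have "x = \<gamma> t" by (simp add: x \<psi>)
    then show "x \<in> range \<gamma>" by (rule range_eqI)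
  qed
  then have "range \<gamma> = sphere a (1 / ?c) \<inter> (+) a ` span {- n, init_dir}"
    using sphere_Int_plane[OF uv, of "1 / ?c" a] c by simp
  then show ?thesis
    unfolding round_circle_def using plane_eq_span[OF uv, of a] c
    by (intro exI[of _ a] exI[of _ "1 / ?c"] exI[of _ "(+) a ` span {- n, init_dir}"]) simp
qed

end

lemma round_circle_parametrization:
  assumes "round_circle (\<Gamma> :: 'a::euclidean_space set)"
  obtains a u v r where "norm u = 1" "norm v = 1" "u \<bullet> v = 0" "r > 0"
    "\<Gamma> = range (\<lambda>t. a + r *\<^sub>R (cos (2 * pi * t) *\<^sub>R u + sin (2 * pi * t) *\<^sub>R v))"
proof -
  obtain a r P where P: "r > 0" "affine P" "aff_dim P = 2" "a \<in> P" "\<Gamma> = sphere a r \<inter> P"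
    using assms unfolding round_circle_def by blast
  let ?S = "(\<lambda>x. x - a) ` P"
  have S: "subspace ?S" by (rule affine_diffs_subspace_subtract[OF P(2,4)])
  have "int (dim ?S) = 2"
    using aff_dim_subspace[OF S] P(3) by (simp add: aff_dim_translation_eq_subtract)
  then have dim: "dim ?S = 2" by simp
  obtain B where B: "pairwise orthogonal B" "\<And>x. x \<in> B \<Longrightarrow> norm x = 1" "card B = dim ?S" "span B = ?S"
    using orthonormal_basis_subspace[OF S] by metis
  obtain u v where uv: "B = {u, v}" "u \<noteq> v" using B(3) unfolding dim card_2_iff by blast
  have "norm u = 1" "norm v = 1" using B(2) uv(1) by auto
  moreover have "u \<bullet> v = 0" using B(1) uv by (simp add: pairwise_def orthogonal_def)
  moreover have "P = (+) a ` span {u, v}"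
    using B(4) unfolding uv(1) by (simp add: image_image)
  ultimately have "\<Gamma> = range (\<lambda>\<phi>. a + r *\<^sub>R (cos \<phi> *\<^sub>R u + sin \<phi> *\<^sub>R v))"
    using sphere_Int_plane[of u v r a] P(1,5) by simp
  also have "\<dots> = range ((\<lambda>\<phi>. a + r *\<^sub>R (cos \<phi> *\<^sub>R u + sin \<phi> *\<^sub>R v)) \<circ> (\<lambda>t. 2 * pi * t))"
  proof -
    have "surj (\<lambda>t. 2 * pi * t)" by (rule surjI[of _ "\<lambda>\<phi>. \<phi> / (2 * pi)"]) simp
    then show ?thesis unfolding image_comp[symmetric] by simp
  qed
  finally show thesis
    using that[of u v r a] \<open>norm u = 1\<close> \<open>norm v = 1\<close> \<open>u \<bullet> v = 0\<close> P(1) by (simp add: o_def)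
qed

text \<open>
  For two points at central angle \<open>y\<close> the chord has squared length \<open>2 r\<^sup>2 (1 - cos y)\<close> and its component
  normal to the tangent has length \<open>r (1 - cos y)\<close>.
\<close>

lemma round_circle_tp_curvature:
  assumes "round_circle (\<Gamma> :: 'a::euclidean_space set)"
  shows "\<exists>\<gamma>. closed_C1_param \<gamma> \<and> \<Gamma> = range \<gamma> \<and>
    (\<forall>s. \<forall>t\<in>{0<..<1}. closed_C1_param.tp_curvature \<gamma> s (s + t) = closed_C1_param.circle_curvature \<gamma>)"
proof -
  obtain a u v r where uv: "norm u = 1" "norm v = 1" "u \<bullet> v = 0" and r: "r > 0"
    and \<Gamma>: "\<Gamma> = range (\<lambda>t. a + r *\<^sub>R (cos (2 * pi * t) *\<^sub>R u + sin (2 * pi * t) *\<^sub>R v))"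
    by (rule round_circle_parametrization[OF assms])
  define \<gamma> where "\<gamma> t = a + r *\<^sub>R (cos (2 * pi * t) *\<^sub>R u + sin (2 * pi * t) *\<^sub>R v)" for t
  define W where "W t = (2 * pi * r) *\<^sub>R (- sin (2 * pi * t) *\<^sub>R u + cos (2 * pi * t) *\<^sub>R v)" for t
  have inner: "(\<alpha> *\<^sub>R u + \<beta> *\<^sub>R v) \<bullet> (\<alpha>' *\<^sub>R u + \<beta>' *\<^sub>R v) = \<alpha> * \<alpha>' + \<beta> * \<beta>'" for \<alpha> \<beta> \<alpha>' \<beta>'
    using uv by (simp add: inner_add_left inner_add_right inner_commute norm_eq_1)
  have D: "(\<gamma> has_vector_derivative W t) (at t)" for t
  proof -
    have "((\<lambda>t. cos (2 * pi * t)) has_real_derivative - (2 * pi * sin (2 * pi * t))) (at t)"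
      "((\<lambda>t. sin (2 * pi * t)) has_real_derivative 2 * pi * cos (2 * pi * t)) (at t)"
      by (auto intro!: derivative_eq_intros)
    then show ?thesis
      unfolding \<gamma>_def[abs_def] W_def
      by (auto intro!: derivative_eq_intros simp: algebra_simps)
  qed
  have V: "vector_derivative \<gamma> (at t) = W t" for t by (rule vector_derivative_at[OF D])
  have "(norm (W t))\<^sup>2 = (2 * pi * r)\<^sup>2" for t
  proof -
    have "- sin (2 * pi * t) * - sin (2 * pi * t) + cos (2 * pi * t) * cos (2 * pi * t) = 1"
      by (simp add: power2_eq_square[symmetric])
    then show ?thesis
      unfolding power2_norm_eq_inner W_def inner_scaleR_left inner_scaleR_right inner
      by (simp only:) (simp add: power2_eq_square)
  qed
  then have norm_W: "norm (W t) = 2 * pi * r" for t using r by (simp add: power2_eq_iff_nonneg)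
  have eq: "\<gamma> s = \<gamma> t \<longleftrightarrow> cos (2 * pi * s) = cos (2 * pi * t) \<and> sin (2 * pi * s) = sin (2 * pi * t)" for s t
  proof -
    have "(\<gamma> s - a) \<bullet> u = r * cos (2 * pi * s)" "(\<gamma> s - a) \<bullet> v = r * sin (2 * pi * s)" for s
      using uv inner_commute[of v u] by (simp_all add: \<gamma>_def inner_add_left norm_eq_1)
    note coord = this
    show ?thesis
    proof
      assume "\<gamma> s = \<gamma> t"
      then have "r * cos (2 * pi * s) = r * cos (2 * pi * t)" "r * sin (2 * pi * s) = r * sin (2 * pi * t)"
        unfolding coord[symmetric] by (simp_all only:)
      then show "cos (2 * pi * s) = cos (2 * pi * t) \<and> sin (2 * pi * s) = sin (2 * pi * t)" using r by simp
    qed (simp add: \<gamma>_def)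
  qed
  interpret closed_C1_param \<gamma>
  proof
    have "continuous_on UNIV W" unfolding W_def[abs_def] by (intro continuous_intros)
    then show "\<gamma> C1_differentiable_on UNIV"
      unfolding C1_differentiable_on_def by (intro exI[of _ W] conjI ballI D)
    show "vector_derivative \<gamma> (at t) \<noteq> 0" for t
      using norm_W[of t] r unfolding V by auto
    show "\<gamma> (t + 1) = \<gamma> t" for t by (simp add: \<gamma>_def distrib_left)
    show "inj_on \<gamma> {0..<1}"
    proof (rule inj_onI)
      fix s t :: real assume st: "s \<in> {0..<1}" "t \<in> {0..<1}" and "\<gamma> s = \<gamma> t"
      then obtain n :: int where "2 * pi * s = 2 * pi * t + 2 * pi * n"
        using sin_cos_eq_iff[of "2 * pi * s" "2 * pi * t"] unfolding eq by blast
      then have "2 * pi * (s - t - n) = 0" by (simp add: algebra_simps)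
      then have n: "s - t = n" by simp
      then have "\<bar>real_of_int n\<bar> < 1" using st by auto
      then have "n = 0" by linarith
      then show "s = t" using n by simp
    qed
  qed
  have arc_length_1: "arc_length 1 = 2 * pi * r" by (simp add: arc_length_def V norm_W)
  have "tp_curvature s (s + t) = circle_curvature" if t: "t \<in> {0<..<1}" for s t
  proof -
    define x where "x = 2 * pi * s"
    define y where "y = 2 * pi * t"
    define w where "w = \<gamma> (s + t) - \<gamma> s"
    have xy: "2 * pi * (s + t) = x + y" by (simp add: x_def y_def distrib_left)
    have w: "w = r *\<^sub>R ((cos (x + y) - cos x) *\<^sub>R u + (sin (x + y) - sin x) *\<^sub>R v)"
      unfolding w_def \<gamma>_def xy x_def[symmetric] by (simp add: algebra_simps)
    have W: "W (s + t) = (2 * pi * r) *\<^sub>R (- sin (x + y) *\<^sub>R u + cos (x + y) *\<^sub>R v)"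
      unfolding W_def xy ..
    have s1: "(sin z)\<^sup>2 = 1 - (cos z)\<^sup>2" for z :: real by (rule sin_squared_eq)
    have cosy: "cos y = cos (x + y) * cos x + sin (x + y) * sin x"
      using cos_diff[of "x + y" x] by simp
    have siny: "sin y = sin (x + y) * cos x - cos (x + y) * sin x"
      using sin_diff[of "x + y" x] by simp
    have "w \<noteq> 0" using curve_neq[of "s + t" s] t by (simp add: w_def)
    have nw: "(norm w)\<^sup>2 = 2 * r\<^sup>2 * (1 - cos y)"
    proof -
      have "(norm w)\<^sup>2 = r\<^sup>2 * ((cos (x + y) - cos x)\<^sup>2 + (sin (x + y) - sin x)\<^sup>2)"
        unfolding power2_norm_eq_inner w inner_scaleR_left inner_scaleR_right inner by (simp add: power2_eq_square)
      also have "(cos (x + y) - cos x)\<^sup>2 + (sin (x + y) - sin x)\<^sup>2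
          = ((sin (x + y))\<^sup>2 + (cos (x + y))\<^sup>2) + ((sin x)\<^sup>2 + (cos x)\<^sup>2) - 2 * cos y"
        unfolding cosy by (simp only: power2_diff) (simp add: algebra_simps)
      finally show ?thesis by (simp add: algebra_simps)
    qed
    have wW: "w \<bullet> W (s + t) = 2 * pi * r\<^sup>2 * sin y"
    proof -
      have "w \<bullet> W (s + t) = r * (2 * pi * r) * ((cos (x + y) - cos x) * - sin (x + y) + (sin (x + y) - sin x) * cos (x + y))"
        unfolding w W inner_scaleR_left inner_scaleR_right inner by simp
      also have "(cos (x + y) - cos x) * - sin (x + y) + (sin (x + y) - sin x) * cos (x + y) = sin y"
        unfolding siny by (simp add: algebra_simps)
      finally show ?thesis by (simp add: power2_eq_square)
    qed
    have "(norm (perp (W (s + t)) w))\<^sup>2 = 2 * r\<^sup>2 * (1 - cos y) - (2 * pi * r\<^sup>2 * sin y)\<^sup>2 / (2 * pi * r)\<^sup>2"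
      unfolding norm_perp_squared nw wW by (simp add: power2_norm_eq_inner[symmetric] norm_W)
    also have "(2 * pi * r\<^sup>2 * sin y)\<^sup>2 / (2 * pi * r)\<^sup>2 = r\<^sup>2 * (sin y)\<^sup>2"
      using r by (simp add: power2_eq_square field_simps)
    also have "2 * r\<^sup>2 * (1 - cos y) - r\<^sup>2 * (sin y)\<^sup>2 = (r * (1 - cos y))\<^sup>2"
      unfolding s1 by (simp add: power2_eq_square algebra_simps)
    finally have np: "norm (perp (W (s + t)) w) = r * (1 - cos y)"
      using r by (simp add: power2_eq_iff_nonneg)
    have "(norm w)\<^sup>2 > 0" using \<open>w \<noteq> 0\<close> by simp
    then have "1 - cos y > 0" unfolding nw using r by (simp add: zero_less_mult_iff)
    have "tp_curvature s (s + t) = 2 * (r * (1 - cos y)) / (2 * r\<^sup>2 * (1 - cos y))"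
      unfolding tp_curvature_def V w_def[symmetric] np nw ..
    also have "\<dots> = 1 / r" using \<open>1 - cos y > 0\<close> r by (simp add: power2_eq_square)
    also have "\<dots> = circle_curvature" using r by (simp add: circle_curvature_def arc_length_1)
    finally show ?thesis .
  qed
  then show ?thesis
    using closed_C1_param_axioms \<Gamma> unfolding \<gamma>_def[abs_def, symmetric] by blast
qed

section \<open>The inequality between energy and length\<close>

theorem corollary5p12:
  fixes \<Gamma> :: "(real ^ 3) set" and p :: real
  assumes "closed_C1_curve \<Gamma>" and "p > 1"
  shows "ennreal (2 * pi) \<le>
           ennpowr (tangent_point_energy p \<Gamma>) (1 / p) * ennpowr (emeasure hausdorff1 \<Gamma>) (1 - 2 / p) \<and>
         (ennreal (2 * pi) =
           ennpowr (tangent_point_energy p \<Gamma>) (1 / p) * ennpowr (emeasure hausdorff1 \<Gamma>) (1 - 2 / p)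
          \<longleftrightarrow> round_circle \<Gamma>)"
proof -
  obtain \<gamma> where \<gamma>: "closed_C1_param \<gamma>" and \<Gamma>: "\<Gamma> = range \<gamma>"
    using assms(1) unfolding closed_C1_curve_def closed_C1_param_def by blast
  interpret closed_C1_param \<gamma> by (rule \<gamma>)
  let ?X = "ennpowr (tangent_point_energy p \<Gamma>) (1 / p) * ennpowr (emeasure hausdorff1 \<Gamma>) (1 - 2 / p)"
  have "round_circle \<Gamma>" if "ennreal (2 * pi) = ?X"
  proof -
    have E: "tangent_point_energy p (range \<gamma>) = ennreal (circle_curvature powr p * (arc_length 1)\<^sup>2)"
      using that two_pi_le_energy_length(2)[OF assms(2)] by (simp add: \<Gamma>)
    note const = energy_minimal_imp_curvature_const[OF assms(2) E]
    have "tp_curvature 0 t = circle_curvature" "tp_curvature t 1 = circle_curvature"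
      if "t \<in> {0<..<1}" for t
      using const[of 0 t] const[of t "1 - t"] that by auto
    then show ?thesis unfolding \<Gamma> by (rule curvature_const_imp_round_circle)
  qed
  moreover have "ennreal (2 * pi) = ?X" if circle: "round_circle \<Gamma>"
  proof -
    obtain \<delta> where \<delta>: "closed_C1_param \<delta>" "\<Gamma> = range \<delta>"
      "\<And>s t. t \<in> {0<..<1} \<Longrightarrow> closed_C1_param.tp_curvature \<delta> s (s + t) = closed_C1_param.circle_curvature \<delta>"
      using round_circle_tp_curvature[OF circle] by blast
    interpret circ: closed_C1_param \<delta> by (rule \<delta>(1))
    show ?thesis
      using circ.two_pi_le_energy_length(2)[OF assms(2)] circ.energy_eq_of_const_curvature[OF assms(2) \<delta>(3)]
      by (simp add: \<delta>(2))
  qed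
  ultimately show ?thesis
    using two_pi_le_energy_length(1)[OF assms(2)] unfolding \<Gamma> by blast
qed

end
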